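(* Let $\alpha<\infty$. There exist constants $0<c(\alpha)\le C(\alpha)<\infty$ depending only on $\alpha$ such that the following holds. Let $n\ge1$ and let $X_1,\ldots,X_n$ be independent mean zero real random variables satisfying $$\|X_i\|_{2p}\le\alpha\|X_i\|_p<\infty\qquad\text{for all }p\ge 1\text{ and }i=1,\ldots,n,$$ and let $X=(X_1,\ldots,X_n)$. Then for every nonempty countable set $S\subset\mathbb{R}^n$, $$c(\alpha)\,m_X(S)\le M_X(S)\le C(\alpha)\,m_X(S).$$
   Context: $\|Z\|_p=(\mathbb{E}|Z|^p)^{1/p}$ for a real random variable $Z$. For $t\in\mathbb{R}^n$ write $X_t=\langle t,X\rangle=\sum_i t_iX_i$. For a nonempty countable set $S\subset\mathbb{R}^n$, $$M_X(S):=\inf_{u>0}\Big[u+\sum_{t\in S}\mathbb{E}|X_t|\mathbf 1_{\{|X_t|\ge u\}}\Big]\in[0,\infty],\qquad m_X(S):=\inf\,\sup_{i}\|X_{t_i}\|_{\log(e+i)}\in[0,\infty],$$ where the infimum in the definition of $m_X(S)$ runs over all enumerations $S=\{t_i\colon 1\le i\le N\}$, $N=|S|\le\infty$, of $S$ (for $N=\infty$, $i$ ranges over all positive integers). *)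

theory Defs
  imports "HOL-Probability.Probability"
begin

definition Lp_norm :: "'a measure \<Rightarrow> real \<Rightarrow> ('a \<Rightarrow> real) \<Rightarrow> ennreal" where
  "Lp_norm M p Z =
     (let I = \<integral>\<^sup>+ \<omega>. ennreal (\<bar>Z \<omega>\<bar> powr p) \<partial>M
      in if I = \<infinity> then \<infinity> else ennreal (enn2real I powr (1 / p)))"

text \<open>
  Since the dimension \<open>n\<close> has to be quantified after the constants, a vector of
  \<open>n\<close>-space is an extensional function on \<open>{1..n}\<close>. Extensionality makes distinct
  functions distinct vectors, which matters for sums over, and enumerations of, sets of vectors.
\<close>

abbreviation vectors :: "nat \<Rightarrow> (nat \<Rightarrow> real) set" where
  "vectors n \<equiv> {1..n} \<rightarrow>\<^sub>E UNIV"

definition lin_form :: "nat \<Rightarrow> (nat \<Rightarrow> 'a \<Rightarrow> real) \<Rightarrow> (nat \<Rightarrow> real) \<Rightarrow> 'a \<Rightarrow> real" where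
  "lin_form n X t \<omega> = (\<Sum>i = 1..n. t i * X i \<omega>)"

definition big_M :: "'a measure \<Rightarrow> nat \<Rightarrow> (nat \<Rightarrow> 'a \<Rightarrow> real) \<Rightarrow> (nat \<Rightarrow> real) set \<Rightarrow> ennreal" where
  "big_M M n X S =
     (INF u \<in> {0<..}. ennreal u +
        (\<Sum>\<^sub>\<infinity>t\<in>S. \<integral>\<^sup>+ \<omega>. ennreal \<bar>lin_form n X t \<omega>\<bar>
                     * indicator {\<omega>. \<bar>lin_form n X t \<omega>\<bar> \<ge> u} \<omega> \<partial>M))"

definition enum_index :: "'b set \<Rightarrow> nat set" where
  "enum_index S = {i. 1 \<le> i \<and> (finite S \<longrightarrow> i \<le> card S)}"

definition small_m :: "'a measure \<Rightarrow> nat \<Rightarrow> (nat \<Rightarrow> 'a \<Rightarrow> real) \<Rightarrow> (nat \<Rightarrow> real) set \<Rightarrow> ennreal" where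
  "small_m M n X S =
     (INF t \<in> {t. bij_betw t (enum_index S) S}.
        SUP i \<in> enum_index S. Lp_norm M (ln (exp 1 + real i)) (lin_form n X (t i)))"

text \<open>
  For \<open>\<alpha> < 0\<close> the coercion \<open>ennreal \<alpha>\<close> is \<open>0\<close>. This does not change the meaning of the
  moment condition, which then forces \<open>X i = 0\<close> almost surely in either reading.
\<close>

definition admissible ::
    "'a measure \<Rightarrow> real \<Rightarrow> nat \<Rightarrow> (nat \<Rightarrow> 'a \<Rightarrow> real) \<Rightarrow> bool" where
  "admissible M \<alpha> n X \<longleftrightarrow>
     prob_space M \<and>
     prob_space.indep_vars M (\<lambda>_. borel) X {1..n} \<and>
     (\<forall>i\<in>{1..n}. has_bochner_integral M (X i) 0) \<and>
     (\<forall>i\<in>{1..n}. \<forall>p\<ge>1. Lp_norm M p (X i) < \<infinity> \<and>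
        Lp_norm M (2 * p) (X i) \<le> ennreal \<alpha> * Lp_norm M p (X i))"

text \<open>
  The type argument is the type of the sample space. A type cannot be quantified under an
  existential quantifier; to express that constants work for random variables on
  probability spaces over any type, they are chosen for sample spaces over \<open>nat \<Rightarrow> real\<close> and then
  asserted to work, unchanged, over an arbitrary type.
\<close>

definition comparison :: "'a itself \<Rightarrow> real \<Rightarrow> real \<Rightarrow> real \<Rightarrow> bool" where
  "comparison _ \<alpha> c C \<longleftrightarrow>
     (\<forall>n\<ge>1. \<forall>(M :: 'a measure) X. admissible M \<alpha> n X \<longrightarrow>
        (\<forall>S \<subseteq> vectors n. S \<noteq> {} \<and> countable S \<longrightarrow>
           ennreal c * small_m M n X S \<le> big_M M n X S \<and>
           big_M M n X S \<le> ennreal C * small_m M n X S))"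

end

theory Submission
  imports Defs
begin

text \<open>
  The key fact is that a linear form \<open>Z\<close> inherits the moment condition:
  \<open>\<parallel>Z\<parallel>_{2p} \<le> \<beta> \<parallel>Z\<parallel>_p\<close> with \<open>\<beta>\<close> depending only on \<open>\<alpha>\<close>. For even \<open>p\<close> and a symmetric \<open>W\<close> whose
  moments double, there is \<open>\<epsilon>\<close> depending only on the doubling constant with
  \<open>\<parallel>b + \<epsilon> W\<parallel>_{2p} \<le> \<parallel>b + W\<parallel>_p\<close> for all \<open>b\<close>; by Minkowski's inequality this property passes to sums of
  independent variables, and the case \<open>b = 0\<close> for the symmetrization \<open>Z - Z'\<close> yields the claim. Only
  dyadic \<open>p\<close> are needed, the others following by monotonicity of the norms.

  Upper bound: if \<open>\<parallel>X_{t_i}\<parallel>_{p_i} \<le> v\<close> with \<open>p_i = log (e + i)\<close>, truncating at \<open>u = e \<beta>^2 v\<close> and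
  applying Markov's inequality to a moment of order at least \<open>2 p_i\<close> leaves a term of size at most
  \<open>u (e + i)^{-2}\<close>, which is summable. Lower bound: enumerate \<open>S\<close> so that the truncated moments are at
  most \<open>2 A / i\<close>, where \<open>A\<close> is the value of the functional at \<open>u\<close>; then \<open>P(|X_{t_i}| \<ge> A) \<le> 2 / i\<close>,
  and the Cauchy-Schwarz inequality with moment doubling (a Paley-Zygmund argument) bounds
  \<open>\<parallel>X_{t_i}\<parallel>_r\<close> by \<open>2 A\<close> for \<open>r\<close> a small multiple of \<open>p_i\<close>.
\<close>

section \<open>Binomial estimates\<close>

lemma sum_even_terms:
  fixes f :: "nat \<Rightarrow> real"
  assumes "\<And>k. odd k \<Longrightarrow> f k = 0"
  shows "(\<Sum>k\<le>2 * n. f k) = (\<Sum>k\<le>n. f (2 * k))"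
  using assms by (induction n) auto

lemma sum_even_odd_split:
  fixes f :: "nat \<Rightarrow> real"
  shows "(\<Sum>k\<le>2 * n. f k) = (\<Sum>j\<le>n. f (2 * j)) + (\<Sum>j<n. f (2 * j + 1))"
  by (induction n) auto

text \<open>In the expanded square on the right, the cross terms of non-neighbouring indices are
  nonnegative and are dropped. The neighbouring products later absorb the terms of odd degree in a
  binomial expansion.\<close>

lemma sum_squares_adjacent_le:
  fixes a :: "nat \<Rightarrow> real"
  assumes "\<And>j. 0 \<le> a j"
  shows "(\<Sum>j\<le>n. (a j)\<^sup>2) + 2 * (\<Sum>j<n. a j * a (Suc j)) \<le> (\<Sum>j\<le>n. a j)\<^sup>2"
proof (induction n)
  case (Suc n)
  have "a n * a (Suc n) \<le> (\<Sum>j\<le>n. a j) * a (Suc n)"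
    by (intro mult_right_mono member_le_sum) (use assms in auto)
  with Suc show ?case
    by (simp add: power2_sum algebra_simps)
qed simp

lemma choose_Suc_ratio: "Suc k * (n choose Suc k) = (n - k) * (n choose k)"
  using binomial_absorption[of k n] binomial_absorb_comp[of n k] by simp

text \<open>With \<open>p = i + d + 2\<close>, the quotient of the left side by
  \<open>(p choose i) * (p choose Suc (Suc i))\<close> is \<open>(i + 2) / (i + 1)\<close> times
  \<open>(d + 2) / (d + 1)\<close>, and both ratios are at most 2.\<close>

lemma choose_square_le_adjacent:
  assumes "Suc i < p"
  shows "(p choose Suc i)\<^sup>2 \<le> 4 * (p choose i) * (p choose Suc (Suc i))"
proof -
  define C where "C = (p choose Suc i)"
  obtain d where p: "p = i + d + 2"
    using assms by (metis add.commute add_2_eq_Suc less_iff_Suc_add add_Suc_shift add_Suc_right)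
  have 1: "(i + 1) * C = (d + 2) * (p choose i)"
    using choose_Suc_ratio[of i p] unfolding C_def p by simp
  have 2: "(i + 2) * (p choose Suc (Suc i)) = (d + 1) * C"
    using choose_Suc_ratio[of "Suc i" p] unfolding C_def p by simp
  have "((i + 2) * (d + 2)) * C\<^sup>2 \<le> (4 * (i + 1) * (d + 1)) * C\<^sup>2"
    by (intro mult_right_mono) (auto simp: algebra_simps)
  also have "\<dots> = 4 * ((i + 1) * C) * ((d + 1) * C)"
    by (simp add: power2_eq_square algebra_simps)
  also have "\<dots> = ((i + 2) * (d + 2)) * (4 * (p choose i) * (p choose Suc (Suc i)))"
    unfolding 1 2[symmetric] by (simp add: algebra_simps)
  finally show ?thesis
    unfolding C_def by (subst (asm) mult_le_cancel1) auto
qed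

text \<open>Consecutive ratios are compared: with \<open>p = k + d + 1\<close>, the left side grows
  by \<open>(2 * d + 1) * (2 * d + 2) / ((2 * k + 1) * (2 * k + 2))\<close>, the right side by the
  larger \<open>4 * (d + 1)\<^sup>2 / (k + 1)\<^sup>2\<close>.\<close>

lemma choose_double_le: "(2 * p) choose (2 * k) \<le> 4 ^ k * (p choose k)\<^sup>2"
proof (induction k)
  case (Suc k)
  show ?case
  proof (cases "k < p")
    case True
    then obtain d where p: "p = k + d + 1"
      by (metis less_iff_Suc_add Suc_eq_plus1)
    have "Suc (2 * k) * ((2 * p) choose Suc (2 * k)) = (2 * d + 2) * ((2 * p) choose (2 * k))"
      using choose_Suc_ratio[of "2 * k" "2 * p"] unfolding p by simp
    moreover have "(2 * k + 2) * ((2 * p) choose (2 * Suc k)) = (2 * d + 1) * ((2 * p) choose Suc (2 * k))"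
      using choose_Suc_ratio[of "Suc (2 * k)" "2 * p"] unfolding p by simp
    ultimately have 1: "(2 * k + 1) * (2 * k + 2) * ((2 * p) choose (2 * Suc k))
        = (2 * d + 1) * (2 * d + 2) * ((2 * p) choose (2 * k))"
      by (metis (no_types, lifting) Suc_eq_plus1 mult.assoc mult.left_commute)
    have 2: "(k + 1) * (p choose Suc k) = (d + 1) * (p choose k)"
      using choose_Suc_ratio[of k p] unfolding p by simp
    have "((2 * k + 1) * (2 * k + 2)) * ((2 * p) choose (2 * Suc k))
        \<le> (2 * d + 1) * (2 * d + 2) * (4 ^ k * (p choose k)\<^sup>2)"
      unfolding 1 using Suc by (intro mult_left_mono) auto
    also have "\<dots> \<le> (2 * d + 2) * (2 * d + 2) * (4 ^ k * (p choose k)\<^sup>2)"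
      by (intro mult_right_mono) auto
    also have "\<dots> = 4 * 4 ^ k * ((d + 1) * (p choose k))\<^sup>2"
      by (simp add: power2_eq_square algebra_simps)
    also have "\<dots> = 4 * 4 ^ k * ((k + 1) * (k + 1)) * (p choose Suc k)\<^sup>2"
      unfolding 2[symmetric] by (simp add: power2_eq_square algebra_simps)
    also have "\<dots> \<le> 4 * 4 ^ k * ((2 * k + 1) * (2 * k + 2)) * (p choose Suc k)\<^sup>2"
      by (intro mult_right_mono mult_left_mono mult_mono) auto
    also have "\<dots> = ((2 * k + 1) * (2 * k + 2)) * (4 ^ Suc k * (p choose Suc k)\<^sup>2)"
      by (simp add: algebra_simps)
    finally show ?thesis
      by (subst (asm) mult_le_cancel1) auto
  qed (simp add: binomial_eq_0)
qed simp

section \<open>Hypercontractivity of one symmetric random variable\<close>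

text \<open>For even \<open>p\<close> this is the norm inequality between exponents
  \<open>2 * p\<close> and \<open>p\<close>, raised to the power \<open>2 * p\<close>. The shift
  \<open>b\<close> is arbitrary so that an independent summand can be absorbed into it; nonnegative
  integrals avoid integrability side conditions.\<close>

definition hypercontractive :: "real \<Rightarrow> nat \<Rightarrow> 'a measure \<Rightarrow> ('a \<Rightarrow> real) \<Rightarrow> bool" where
  "hypercontractive \<epsilon> p M W \<longleftrightarrow>
     (\<forall>b. (\<integral>\<^sup>+x. ennreal ((b + \<epsilon> * W x) ^ (2 * p)) \<partial>M) \<le> (\<integral>\<^sup>+x. ennreal ((b + W x) ^ p) \<partial>M)\<^sup>2)"

text \<open>The Cauchy-Schwarz inequality, carried over from nonnegative integrals; the product is
  integrable because \<open>\<bar>a * b\<bar> \<le> a\<^sup>2 + b\<^sup>2\<close>.\<close>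

lemma integral_mult_square_le:
  fixes f g :: "'a \<Rightarrow> real"
  assumes [measurable]: "f \<in> borel_measurable M" "g \<in> borel_measurable M"
    and f: "integrable M (\<lambda>x. (f x)\<^sup>2)" and g: "integrable M (\<lambda>x. (g x)\<^sup>2)"
  shows "(\<integral>x. \<bar>f x * g x\<bar> \<partial>M)\<^sup>2 \<le> (\<integral>x. (f x)\<^sup>2 \<partial>M) * (\<integral>x. (g x)\<^sup>2 \<partial>M)"
proof -
  have fg: "integrable M (\<lambda>x. \<bar>f x * g x\<bar>)"
  proof (rule Bochner_Integration.integrable_bound)
    show "integrable M (\<lambda>x. (f x)\<^sup>2 + (g x)\<^sup>2)"
      using f g by simp
    have "\<bar>a * b\<bar> \<le> a\<^sup>2 + b\<^sup>2" for a b :: real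
    proof -
      have "0 \<le> \<bar>a\<bar> * \<bar>b\<bar>"
        by simp
      moreover have "2 * (\<bar>a\<bar> * \<bar>b\<bar>) \<le> a\<^sup>2 + b\<^sup>2"
        using sum_squares_bound[of "\<bar>a\<bar>" "\<bar>b\<bar>"] by (simp add: mult.assoc)
      ultimately show ?thesis
        unfolding abs_mult by linarith
    qed
    then show "AE x in M. norm \<bar>f x * g x\<bar> \<le> norm ((f x)\<^sup>2 + (g x)\<^sup>2)"
      by auto
  qed auto
  have "(\<integral>\<^sup>+x. ennreal \<bar>f x\<bar> * ennreal \<bar>g x\<bar> \<partial>M)\<^sup>2
      \<le> (\<integral>\<^sup>+x. (ennreal \<bar>f x\<bar>)\<^sup>2 \<partial>M) * (\<integral>\<^sup>+x. (ennreal \<bar>g x\<bar>)\<^sup>2 \<partial>M)"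
    by (rule Cauchy_Schwarz_nn_integral) auto
  then have "(\<integral>\<^sup>+x. ennreal \<bar>f x * g x\<bar> \<partial>M)\<^sup>2
      \<le> (\<integral>\<^sup>+x. ennreal ((f x)\<^sup>2) \<partial>M) * (\<integral>\<^sup>+x. ennreal ((g x)\<^sup>2) \<partial>M)"
    by (simp add: ennreal_mult[symmetric] ennreal_power abs_mult)
  then show ?thesis
    using f g fg by (simp add: nn_integral_eq_integral ennreal_power ennreal_mult[symmetric])
qed

text \<open>Expanding both sides binomially, the term of degree \<open>2 * k\<close> on the left is dominated by the
  square of the absolute term of degree \<open>k\<close> on the right; for odd \<open>k\<close>, where the right-hand side
  has no such term, that square is in turn dominated by the product of the two neighbouring terms.\<close>

lemma (in prob_space) hypercontractive_symmetric:
  fixes W :: "'a \<Rightarrow> real"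
  assumes [measurable]: "W \<in> borel_measurable M"
    and int: "\<And>k. integrable M (\<lambda>x. W x ^ k)"
    and odd: "\<And>k. odd k \<Longrightarrow> expectation (\<lambda>x. W x ^ k) = 0"
    and double: "\<And>k. 1 \<le> k \<Longrightarrow>
      expectation (\<lambda>x. W x ^ (2 * k)) \<le> B ^ (2 * k) * (expectation (\<lambda>x. \<bar>W x\<bar> ^ k))\<^sup>2"
    and \<epsilon>: "8 * (\<epsilon> * B)\<^sup>2 \<le> 1"
    and p: "even p"
  shows "hypercontractive \<epsilon> p M W"
  unfolding hypercontractive_def
proof
  fix b :: real
  obtain q where q: "p = 2 * q"
    using p by auto
  define m where "m k = expectation (\<lambda>x. W x ^ k)" for k
  define \<mu> where "\<mu> k = expectation (\<lambda>x. \<bar>W x\<bar> ^ k)" for k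
  \<comment> \<open>Odd moments vanish, so \<open>a\<close> lists the surviving terms on the right
    and \<open>T\<close> those on the left. \<open>N\<close> uses absolute moments and is therefore
    informative at odd degrees too.\<close>
  define a where "a j = real (p choose (2 * j)) * m (2 * j) * b ^ (p - 2 * j)" for j
  define T where "T k = real (2 * p choose (2 * k)) * \<epsilon> ^ (2 * k) * m (2 * k) * b ^ (2 * (p - k))" for k
  define N where "N k = real (p choose k) * \<mu> k * \<bar>b\<bar> ^ (p - k)" for k
  \<comment> \<open>The factor 4 comes from \<open>choose_double_le\<close>, the square from
    \<epsilon> and the doubling constant \<open>B\<close>.\<close>
  define \<theta> where "\<theta> = 4 * (\<epsilon> * B)\<^sup>2"
  have \<theta>: "0 \<le> \<theta>" "\<theta> \<le> 1/2"
    using \<epsilon> by (auto simp: \<theta>_def)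
  have m_even: "\<mu> (2 * j) = m (2 * j)" for j
    unfolding m_def \<mu>_def by (simp add: power_mult)
  have \<mu>_nonneg: "0 \<le> \<mu> k" for k
    unfolding \<mu>_def by (rule integral_nonneg_AE) auto
  have expand: "integrable M (\<lambda>x. (b + c * W x) ^ n) \<and>
      expectation (\<lambda>x. (b + c * W x) ^ n) = (\<Sum>k\<le>n. real (n choose k) * c ^ k * m k * b ^ (n - k))" for c n
  proof -
    have *: "(\<lambda>x. (b + c * W x) ^ n) = (\<lambda>x. \<Sum>k\<le>n. (real (n choose k) * c ^ k * b ^ (n - k)) * W x ^ k)"
      using binomial_ring[of "c * W _" b n] by (simp add: add.commute power_mult_distrib mult_ac)
    show ?thesis
      unfolding * m_def using int by (simp add: Bochner_Integration.integral_sum mult_ac)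
  qed
  have m_odd: "m k = 0" if "odd k" for k
    using odd[OF that] by (simp add: m_def)
  have a_nonneg: "0 \<le> a j" for j
  proof (cases "2 * j \<le> p")
    case True
    then have "even (p - 2 * j)"
      using p by simp
    then show ?thesis
      unfolding a_def m_even[symmetric] by (intro mult_nonneg_nonneg \<mu>_nonneg zero_le_even_power) auto
  qed (simp add: a_def binomial_eq_0)
  have lhs: "expectation (\<lambda>x. (b + \<epsilon> * W x) ^ (2 * p)) = (\<Sum>k\<le>p. T k)"
    using expand[of \<epsilon> "2 * p"] unfolding T_def
    by (subst (asm) sum_even_terms) (auto simp: m_odd diff_mult_distrib2)
  have rhs: "expectation (\<lambda>x. (b + W x) ^ p) = (\<Sum>j\<le>q. a j)"
    using expand[of 1 p] unfolding a_def q
    by (subst (asm) sum_even_terms) (auto simp: m_odd)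
  have T_le: "T k \<le> \<theta> ^ k * (N k)\<^sup>2" for k
  proof -
    have "m (2 * k) \<le> B ^ (2 * k) * (\<mu> k)\<^sup>2"
      using double[of k] by (cases "k = 0") (auto simp: m_def \<mu>_def prob_space)
    moreover have "real (2 * p choose (2 * k)) \<le> 4 ^ k * (real (p choose k))\<^sup>2"
      using of_nat_mono[OF choose_double_le[of p k], where 'a = real] by simp
    moreover have "0 \<le> m (2 * k)"
      using \<mu>_nonneg[of "2 * k"] by (simp add: m_even)
    ultimately have "real (2 * p choose (2 * k)) * m (2 * k)
        \<le> (4 ^ k * (real (p choose k))\<^sup>2) * (B ^ (2 * k) * (\<mu> k)\<^sup>2)"
      by (intro mult_mono) auto
    then have "(real (2 * p choose (2 * k)) * m (2 * k)) * (\<epsilon> ^ (2 * k) * b ^ (2 * (p - k)))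
        \<le> ((4 ^ k * (real (p choose k))\<^sup>2) * (B ^ (2 * k) * (\<mu> k)\<^sup>2)) * (\<epsilon> ^ (2 * k) * b ^ (2 * (p - k)))"
      by (intro mult_right_mono) (auto simp: power_mult)
    moreover have "b ^ (2 * (p - k)) = (\<bar>b\<bar> ^ (p - k))\<^sup>2"
      by (simp add: power_even_eq flip: power_abs)
    moreover have "\<theta> ^ k = 4 ^ k * B ^ (2 * k) * \<epsilon> ^ (2 * k)"
      by (simp add: \<theta>_def power_mult_distrib flip: power_mult)
    ultimately show ?thesis
      unfolding T_def N_def by (simp add: power_mult_distrib mult_ac)
  qed
  have N_even: "(N (2 * j))\<^sup>2 = (a j)\<^sup>2" for j
    unfolding N_def a_def m_even by (simp add: power_mult_distrib flip: power_abs)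
  \<comment> \<open>Cauchy-Schwarz bounds the odd absolute moment by its two even neighbours; the
    binomial coefficients cost the factor 4.\<close>
  have N_odd: "(N (2 * j + 1))\<^sup>2 \<le> 4 * (a j * a (Suc j))" if "j < q" for j
  proof -
    have "\<bar>W x ^ j * W x ^ Suc j\<bar> = \<bar>W x\<bar> ^ (2 * j + 1)" for x
      by (simp add: abs_mult power_abs mult_2 power_add)
    moreover have "(\<integral>x. \<bar>W x ^ j * W x ^ Suc j\<bar> \<partial>M)\<^sup>2 \<le> (\<integral>x. (W x ^ j)\<^sup>2 \<partial>M) * (\<integral>x. (W x ^ Suc j)\<^sup>2 \<partial>M)"
      by (rule integral_mult_square_le) (use int[of "2 * j"] int[of "2 * Suc j"] in \<open>simp_all only: power_even_eq\<close>, measurable)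
    ultimately have 1: "(\<mu> (2 * j + 1))\<^sup>2 \<le> m (2 * j) * m (2 * Suc j)"
      unfolding \<mu>_def m_def power_even_eq by simp
    have "Suc (2 * j) < p"
      using that q by simp
    then have 2: "(real (p choose (2 * j + 1)))\<^sup>2 \<le> 4 * (p choose (2 * j)) * (p choose (2 * Suc j))"
      using of_nat_mono[OF choose_square_le_adjacent, where 'a = real] by fastforce
    have 3: "(\<bar>b\<bar> ^ (p - (2 * j + 1)))\<^sup>2 = b ^ (p - 2 * j) * b ^ (p - 2 * Suc j)"
    proof -
      have "2 * j + 2 \<le> p"
        using that q by simp
      then obtain d where "p = 2 * j + 2 + d"
        using le_Suc_ex by blast
      then show ?thesis
        by (simp add: power2_eq_square mult_ac flip: power_abs)
    qed
    have "(N (2 * j + 1))\<^sup>2 = ((real (p choose (2 * j + 1)))\<^sup>2 * (\<mu> (2 * j + 1))\<^sup>2) * (\<bar>b\<bar> ^ (p - (2 * j + 1)))\<^sup>2"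
      unfolding N_def by (simp add: power_mult_distrib)
    also have "\<dots> \<le> ((4 * (p choose (2 * j)) * (p choose (2 * Suc j))) * (m (2 * j) * m (2 * Suc j)))
        * (\<bar>b\<bar> ^ (p - (2 * j + 1)))\<^sup>2"
      by (intro mult_right_mono mult_mono 1 2) auto
    also have "\<dots> = 4 * (a j * a (Suc j))"
      unfolding 3 a_def by (simp add: mult_ac)
    finally show ?thesis .
  qed
  have T_even: "T (2 * j) \<le> (a j)\<^sup>2" for j
  proof -
    have "\<theta> ^ (2 * j) * (a j)\<^sup>2 \<le> 1 * (a j)\<^sup>2"
      using \<theta> by (intro mult_right_mono power_le_one) auto
    then show ?thesis
      using T_le[of "2 * j"] N_even[of j] by simp
  qed
  \<comment> \<open>The 4 of \<open>N_odd\<close> times \<theta> \<le> 1/2 leaves 2, exactly the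
    coefficient of a neighbouring product in the square of a sum.\<close>
  have T_odd: "T (2 * j + 1) \<le> 2 * (a j * a (Suc j))" if "j < q" for j
  proof -
    have "\<theta> ^ (2 * j) * \<theta> \<le> 1 * (1/2)"
      using \<theta> by (intro mult_mono power_le_one) auto
    then have "\<theta> ^ (2 * j + 1) * (N (2 * j + 1))\<^sup>2 \<le> 1/2 * (4 * (a j * a (Suc j)))"
      by (intro mult_mono N_odd that) (auto simp: mult.commute)
    then show ?thesis
      using T_le[of "2 * j + 1"] by simp
  qed
  have "(\<Sum>k\<le>p. T k) \<le> (\<Sum>j\<le>q. (a j)\<^sup>2) + (\<Sum>j<q. 2 * (a j * a (Suc j)))"
    unfolding q sum_even_odd_split by (intro add_mono sum_mono T_even T_odd) auto
  also have "\<dots> \<le> (\<Sum>j\<le>q. a j)\<^sup>2"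
    using sum_squares_adjacent_le[of a q] a_nonneg by (simp add: sum_distrib_left)
  finally have "expectation (\<lambda>x. (b + \<epsilon> * W x) ^ (2 * p)) \<le> (expectation (\<lambda>x. (b + W x) ^ p))\<^sup>2"
    by (simp add: lhs rhs)
  moreover have "(\<integral>\<^sup>+x. ennreal ((b + \<epsilon> * W x) ^ (2 * p)) \<partial>M) = ennreal (expectation (\<lambda>x. (b + \<epsilon> * W x) ^ (2 * p)))"
    using expand[of \<epsilon> "2 * p"] by (intro nn_integral_eq_integral) (auto simp: zero_le_even_power)
  moreover have "(\<integral>\<^sup>+x. ennreal ((b + W x) ^ p) \<partial>M) = ennreal (expectation (\<lambda>x. (b + W x) ^ p))"
    using expand[of 1 p] p by (intro nn_integral_eq_integral) (auto simp: zero_le_even_power)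
  moreover have "0 \<le> expectation (\<lambda>x. (b + W x) ^ p)"
    using p by (intro integral_nonneg_AE) (auto simp: zero_le_even_power)
  ultimately show "(\<integral>\<^sup>+x. ennreal ((b + \<epsilon> * W x) ^ (2 * p)) \<partial>M) \<le> (\<integral>\<^sup>+x. ennreal ((b + W x) ^ p) \<partial>M)\<^sup>2"
    by (simp add: ennreal_power)
qed

section \<open>Tensorization and symmetrization\<close>

lemma ennreal_power2_le_imp_le:
  fixes a b :: ennreal
  assumes "a\<^sup>2 \<le> b\<^sup>2"
  shows "a \<le> b"
proof (cases b)
  case (real s)
  with assms have "a\<^sup>2 < \<infinity>"
    by (auto simp: ennreal_power intro: le_less_trans)
  then obtain r where "0 \<le> r" "a = ennreal r"
    by (cases a) (auto simp: power2_eq_square)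
  with assms real show ?thesis
    by (simp add: ennreal_power power_mono_iff)
qed simp

text \<open>For fixed \<open>y\<close>, the hypothesis on \<open>f\<close> applies with shift
  \<open>b + \<epsilon> * g y\<close>; Minkowski's integral inequality with exponent 2 exchanges the
  integrations; for fixed \<open>x\<close>, the hypothesis on \<open>g\<close> applies with shift
  \<open>b + f x\<close>.\<close>

lemma hypercontractive_pair:
  fixes f :: "'a \<Rightarrow> real" and g :: "'b \<Rightarrow> real"
  assumes "sigma_finite_measure A" "sigma_finite_measure B"
    and [measurable]: "f \<in> borel_measurable A" "g \<in> borel_measurable B"
    and hf: "hypercontractive \<epsilon> p A f" and hg: "hypercontractive \<epsilon> p B g" and p: "even p"
  shows "hypercontractive \<epsilon> p (A \<Otimes>\<^sub>M B) (\<lambda>(x, y). f x + g y)"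
  unfolding hypercontractive_def
proof
  fix b :: real
  interpret A: sigma_finite_measure A by fact
  interpret B: sigma_finite_measure B by fact
  interpret pair_sigma_finite A B ..
  define h where "h x y = ennreal ((b + \<epsilon> * g y + f x) ^ p)" for x y
  define F where "F x = (\<integral>\<^sup>+y. ennreal ((b + f x + g y) ^ p) \<partial>B)" for x
  have [measurable]: "(\<lambda>(x, y). h x y) \<in> borel_measurable (A \<Otimes>\<^sub>M B)" "F \<in> borel_measurable A"
    unfolding h_def F_def by measurable
  have [measurable]: "(\<lambda>x. h x y) \<in> borel_measurable A" for y
    unfolding h_def by measurable
  have nonneg: "0 \<le> a ^ p" for a :: real
    using p by (rule zero_le_even_power)
  have F_bound: "(\<integral>\<^sup>+y. h x y * h x' y \<partial>B) \<le> F x * F x'" for x x'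
  proof (rule ennreal_power2_le_imp_le)
    have "(\<integral>\<^sup>+y. (h x y)\<^sup>2 \<partial>B) \<le> (F x)\<^sup>2" for x
    proof -
      have "(h x y)\<^sup>2 = ennreal ((b + f x + \<epsilon> * g y) ^ (2 * p))" for y
        unfolding h_def by (simp add: nonneg ennreal_power power_even_eq add_ac)
      then show ?thesis
        using hg unfolding hypercontractive_def F_def by simp
    qed
    then have "(\<integral>\<^sup>+y. (h x y)\<^sup>2 \<partial>B) * (\<integral>\<^sup>+y. (h x' y)\<^sup>2 \<partial>B) \<le> (F x)\<^sup>2 * (F x')\<^sup>2"
      by (intro mult_mono) auto
    moreover have "(\<integral>\<^sup>+y. h x y * h x' y \<partial>B)\<^sup>2 \<le> (\<integral>\<^sup>+y. (h x y)\<^sup>2 \<partial>B) * (\<integral>\<^sup>+y. (h x' y)\<^sup>2 \<partial>B)"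
      unfolding h_def by (rule Cauchy_Schwarz_nn_integral) auto
    ultimately show "(\<integral>\<^sup>+y. h x y * h x' y \<partial>B)\<^sup>2 \<le> (F x * F x')\<^sup>2"
      by (simp add: power_mult_distrib)
  qed
  have "(\<integral>\<^sup>+z. ennreal ((b + \<epsilon> * (case z of (x, y) \<Rightarrow> f x + g y)) ^ (2 * p)) \<partial>(A \<Otimes>\<^sub>M B))
      = (\<integral>\<^sup>+y. \<integral>\<^sup>+x. ennreal ((b + \<epsilon> * g y + \<epsilon> * f x) ^ (2 * p)) \<partial>A \<partial>B)"
    by (subst nn_integral_snd[symmetric]) (auto simp: algebra_simps)
  also have "\<dots> \<le> (\<integral>\<^sup>+y. (\<integral>\<^sup>+x. h x y \<partial>A)\<^sup>2 \<partial>B)"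
    using hf unfolding hypercontractive_def h_def by (intro nn_integral_mono) auto
  \<comment> \<open>Writing the square as a double integral reduces Minkowski's inequality to Fubini
    and the Cauchy-Schwarz bound \<open>F_bound\<close>.\<close>
  also have "\<dots> = (\<integral>\<^sup>+y. \<integral>\<^sup>+x. \<integral>\<^sup>+x'. h x y * h x' y \<partial>A \<partial>A \<partial>B)"
    by (simp add: nn_integral_cmult nn_integral_multc power2_eq_square)
  also have "\<dots> = (\<integral>\<^sup>+x. \<integral>\<^sup>+y. \<integral>\<^sup>+x'. h x y * h x' y \<partial>A \<partial>B \<partial>A)"
    by (rule Fubini') measurable
  also have "\<dots> = (\<integral>\<^sup>+x. \<integral>\<^sup>+x'. \<integral>\<^sup>+y. h x y * h x' y \<partial>B \<partial>A \<partial>A)"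
    by (intro nn_integral_cong Fubini') measurable
  also have "\<dots> \<le> (\<integral>\<^sup>+x. \<integral>\<^sup>+x'. F x * F x' \<partial>A \<partial>A)"
    by (intro nn_integral_mono F_bound)
  also have "\<dots> = (\<integral>\<^sup>+x. F x \<partial>A)\<^sup>2"
    by (simp add: nn_integral_cmult nn_integral_multc power2_eq_square)
  also have "(\<integral>\<^sup>+x. F x \<partial>A) = (\<integral>\<^sup>+z. ennreal ((b + (case z of (x, y) \<Rightarrow> f x + g y)) ^ p) \<partial>(A \<Otimes>\<^sub>M B))"
    unfolding F_def by (subst B.nn_integral_fst[symmetric]) (auto simp: algebra_simps)
  finally show "(\<integral>\<^sup>+z. ennreal ((b + \<epsilon> * (case z of (x, y) \<Rightarrow> f x + g y)) ^ (2 * p)) \<partial>(A \<Otimes>\<^sub>M B))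
      \<le> (\<integral>\<^sup>+z. ennreal ((b + (case z of (x, y) \<Rightarrow> f x + g y)) ^ p) \<partial>(A \<Otimes>\<^sub>M B))\<^sup>2" .
qed

text \<open>On \<open>M \<Otimes>\<^sub>M M\<close> this is the difference of two independent copies
  of \<open>Z\<close>, so its law is symmetric whatever the law of \<open>Z\<close>.\<close>

definition symmetrization :: "('a \<Rightarrow> real) \<Rightarrow> 'a \<times> 'a \<Rightarrow> real" where
  "symmetrization Z = (\<lambda>(x, y). Z x - Z y)"

lemma symmetrization_measurable [measurable]:
  assumes [measurable]: "Z \<in> borel_measurable M"
  shows "symmetrization Z \<in> borel_measurable (M \<Otimes>\<^sub>M M)"
  unfolding symmetrization_def by measurable

text \<open>The joint law of independent variables is the product of their laws, so \<open>Y\<close>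
  may be evaluated at a separate sample point.\<close>

lemma (in prob_space) nn_integral_indep_var:
  fixes R Y :: "'a \<Rightarrow> real"
  assumes indep: "indep_var borel R borel Y"
    and [measurable]: "(\<lambda>(u, v). \<phi> u v) \<in> borel_measurable (borel \<Otimes>\<^sub>M borel)"
  shows "(\<integral>\<^sup>+x. \<phi> (R x) (Y x) \<partial>M) = (\<integral>\<^sup>+x. \<integral>\<^sup>+y. \<phi> (R x) (Y y) \<partial>M \<partial>M)"
proof -
  have [measurable]: "R \<in> borel_measurable M" "Y \<in> borel_measurable M"
    using indep by (auto dest: indep_var_rv1 indep_var_rv2)
  interpret R: prob_space "distr M borel R" by (rule prob_space_distr) measurable
  interpret Y: prob_space "distr M borel Y" by (rule prob_space_distr) measurable
  have "(\<integral>\<^sup>+x. \<phi> (R x) (Y x) \<partial>M)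
      = (\<integral>\<^sup>+z. (case z of (u, v) \<Rightarrow> \<phi> u v) \<partial>distr M (borel \<Otimes>\<^sub>M borel) (\<lambda>x. (R x, Y x)))"
    by (subst nn_integral_distr) auto
  also have "distr M (borel \<Otimes>\<^sub>M borel) (\<lambda>x. (R x, Y x)) = distr M borel R \<Otimes>\<^sub>M distr M borel Y"
    using indep unfolding indep_var_distribution_eq by simp
  also have "(\<integral>\<^sup>+z. (case z of (u, v) \<Rightarrow> \<phi> u v) \<partial>(distr M borel R \<Otimes>\<^sub>M distr M borel Y))
      = (\<integral>\<^sup>+u. \<integral>\<^sup>+v. \<phi> u v \<partial>distr M borel Y \<partial>distr M borel R)"
    by (subst Y.nn_integral_fst[symmetric]) auto
  also have "\<dots> = (\<integral>\<^sup>+x. \<integral>\<^sup>+y. \<phi> (R x) (Y y) \<partial>M \<partial>M)"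
    by (simp add: nn_integral_distr)
  finally show ?thesis .
qed

text \<open>The symmetrized sum has the same law as the sum of the two symmetrizations on separate
  copies of \<open>M \<Otimes>\<^sub>M M\<close>, to which \<open>hypercontractive_pair\<close>
  applies. The equality in law, \<open>transfer\<close>, uses independence once for each copy of the
  sum.\<close>

lemma (in prob_space) hypercontractive_indep_add:
  fixes R Y :: "'a \<Rightarrow> real"
  assumes indep: "indep_var borel R borel Y"
    and R: "hypercontractive \<epsilon> p (M \<Otimes>\<^sub>M M) (symmetrization R)"
    and Y: "hypercontractive \<epsilon> p (M \<Otimes>\<^sub>M M) (symmetrization Y)"
    and p: "even p"
  shows "hypercontractive \<epsilon> p (M \<Otimes>\<^sub>M M) (symmetrization (\<lambda>x. R x + Y x))"
proof -
  have [measurable]: "R \<in> borel_measurable M" "Y \<in> borel_measurable M"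
    using indep by (auto dest: indep_var_rv1 indep_var_rv2)
  interpret MM: pair_prob_space M M ..
  have sf: "sigma_finite_measure (M \<Otimes>\<^sub>M M)" ..
  have transfer: "(\<integral>\<^sup>+z. G (symmetrization (\<lambda>x. R x + Y x) z) \<partial>(M \<Otimes>\<^sub>M M))
      = (\<integral>\<^sup>+w. G (case w of (x, y) \<Rightarrow> symmetrization R x + symmetrization Y y) \<partial>((M \<Otimes>\<^sub>M M) \<Otimes>\<^sub>M (M \<Otimes>\<^sub>M M)))"
    if [measurable]: "G \<in> borel_measurable borel" for G :: "real \<Rightarrow> ennreal"
  proof -
    have "(\<integral>\<^sup>+z. G (symmetrization (\<lambda>x. R x + Y x) z) \<partial>(M \<Otimes>\<^sub>M M))
        = (\<integral>\<^sup>+x. \<integral>\<^sup>+y. G (R x + Y x - (R y + Y y)) \<partial>M \<partial>M)"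
      unfolding symmetrization_def by (subst nn_integral_fst[symmetric]) auto
    also have "\<dots> = (\<integral>\<^sup>+x. \<integral>\<^sup>+x'. \<integral>\<^sup>+y. G (R x + Y x' - (R y + Y y)) \<partial>M \<partial>M \<partial>M)"
    proof -
      have "(\<lambda>(u, v). \<integral>\<^sup>+y. G (u + v - (R y + Y y)) \<partial>M) \<in> borel_measurable (borel \<Otimes>\<^sub>M borel)"
        by measurable
      from nn_integral_indep_var[OF indep this] show ?thesis .
    qed
    also have "\<dots> = (\<integral>\<^sup>+x. \<integral>\<^sup>+x'. \<integral>\<^sup>+y. \<integral>\<^sup>+y'. G (R x + Y x' - (R y + Y y')) \<partial>M \<partial>M \<partial>M \<partial>M)"
    proof -
      have "(\<lambda>(u, v). G (c - (u + v))) \<in> borel_measurable (borel \<Otimes>\<^sub>M borel)" for c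
        by measurable
      from nn_integral_indep_var[OF indep this] show ?thesis by simp
    qed
    also have "\<dots> = (\<integral>\<^sup>+x. \<integral>\<^sup>+y. \<integral>\<^sup>+x'. \<integral>\<^sup>+y'. G (R x + Y x' - (R y + Y y')) \<partial>M \<partial>M \<partial>M \<partial>M)"
      by (intro nn_integral_cong MM.Fubini') measurable
    also have "\<dots> = (\<integral>\<^sup>+x. \<integral>\<^sup>+y. \<integral>\<^sup>+z. G (R x - R y + symmetrization Y z) \<partial>(M \<Otimes>\<^sub>M M) \<partial>M \<partial>M)"
      unfolding symmetrization_def
      by (subst nn_integral_fst[symmetric]) (auto simp: algebra_simps)
    also have "\<dots> = (\<integral>\<^sup>+w. \<integral>\<^sup>+z. G (symmetrization R w + symmetrization Y z) \<partial>(M \<Otimes>\<^sub>M M) \<partial>(M \<Otimes>\<^sub>M M))"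
      by (subst nn_integral_fst[symmetric]) (auto simp: symmetrization_def)
    also have "\<dots> = (\<integral>\<^sup>+w. G (case w of (x, y) \<Rightarrow> symmetrization R x + symmetrization Y y) \<partial>((M \<Otimes>\<^sub>M M) \<Otimes>\<^sub>M (M \<Otimes>\<^sub>M M)))"
      by (subst sigma_finite_measure.nn_integral_fst[OF sf, symmetric]) auto
    finally show ?thesis .
  qed
  have "hypercontractive \<epsilon> p ((M \<Otimes>\<^sub>M M) \<Otimes>\<^sub>M (M \<Otimes>\<^sub>M M)) (\<lambda>(x, y). symmetrization R x + symmetrization Y y)"
    by (rule hypercontractive_pair[OF sf sf _ _ R Y p]) auto
  then show ?thesis
    unfolding hypercontractive_def
    using transfer[of "\<lambda>u. ennreal ((_ + \<epsilon> * u) ^ (2 * p))"] transfer[of "\<lambda>u. ennreal ((_ + u) ^ p)"]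
    by simp
qed

lemma (in prob_space) hypercontractive_indep_sum:
  fixes X :: "'i \<Rightarrow> 'a \<Rightarrow> real"
  assumes "finite I" and "indep_vars (\<lambda>_. borel) X I"
    and "\<And>i. i \<in> I \<Longrightarrow> hypercontractive \<epsilon> p (M \<Otimes>\<^sub>M M) (symmetrization (X i))"
    and p: "even p"
  shows "hypercontractive \<epsilon> p (M \<Otimes>\<^sub>M M) (symmetrization (\<lambda>x. \<Sum>i\<in>I. X i x))"
  using assms(1-3)
proof (induction I)
  case empty
  interpret MM: pair_prob_space M M ..
  show ?case
    unfolding hypercontractive_def symmetrization_def
    using p by (simp add: case_prod_beta MM.emeasure_space_1 ennreal_power zero_le_even_power power_even_eq)
next
  case (insert i I)
  have "indep_var borel (X i) borel (\<lambda>x. \<Sum>i\<in>I. X i x)"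
    by (intro indep_vars_sum insert)
  moreover have "indep_vars (\<lambda>_. borel) X I"
    by (rule indep_vars_subset[OF insert.prems(1)]) auto
  ultimately show ?case
    using insert p by (simp add: hypercontractive_indep_add)
qed

section \<open>Moments of sums of independent random variables\<close>

lemma powr_of_nat:
  assumes "0 \<le> x" "1 \<le> k"
  shows "x powr real k = x ^ k"
  using assms by (cases "x = 0") (auto simp: powr_realpow)

text \<open>Bernoulli's inequality for a real exponent: a convex function lies above its tangent at
  1. The point 0 is separate because convexity is used on the open half-line.\<close>

lemma powr_above_tangent:
  fixes x s :: real
  assumes "0 \<le> x" "1 \<le> s"
  shows "1 + s * (x - 1) \<le> x powr s"
proof (cases "x = 0")
  case False
  have "((\<lambda>x. x powr s) has_real_derivative s) (at 1 within {0<..})"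
    by (auto intro!: derivative_eq_intros)
  then have "s * (x - 1) \<le> x powr s - 1 powr s"
    using assms False
    by (intro convex_on_imp_above_tangent[OF powr_convex]) (auto simp: interior_open)
  then show ?thesis
    by simp
qed (use assms in simp)

text \<open>Jensen's inequality: after scaling \<open>V\<close> by its expectation, the tangent
  bound is integrated and its linear part vanishes.\<close>

lemma (in prob_space) powr_expectation_le:
  fixes V :: "'a \<Rightarrow> real"
  assumes V: "integrable M V" "\<And>x. 0 \<le> V x" and Vs: "integrable M (\<lambda>x. V x powr s)" and s: "1 \<le> s"
  shows "expectation V powr s \<le> expectation (\<lambda>x. V x powr s)"
proof (cases "expectation V = 0")
  case True
  then show ?thesis
    by (simp add: integral_nonneg_AE)
next
  case False
  let ?a = "expectation V"
  have a: "0 < ?a"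
    using False V by (simp add: order_less_le integral_nonneg_AE)
  have "?a powr s * (1 + s * (V x / ?a - 1)) \<le> V x powr s" for x
  proof -
    have "?a powr s * (1 + s * (V x / ?a - 1)) \<le> ?a powr s * (V x / ?a) powr s"
      using a V(2) s by (intro mult_left_mono powr_above_tangent) auto
    then show ?thesis
      using a V(2) by (simp add: powr_divide)
  qed
  then have "expectation (\<lambda>x. ?a powr s * (1 + s * (V x / ?a - 1))) \<le> expectation (\<lambda>x. V x powr s)"
    using V Vs by (intro integral_mono) auto
  also have "expectation (\<lambda>x. ?a powr s * (1 + s * (V x / ?a - 1))) = ?a powr s"
    using V a by (simp add: prob_space)
  finally show ?thesis .
qed

lemma (in prob_space) power_expectation_le:
  fixes V :: "'a \<Rightarrow> real"
  assumes V: "integrable M V" "\<And>x. 0 \<le> V x" and Vk: "integrable M (\<lambda>x. V x ^ k)"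
  shows "expectation V ^ k \<le> expectation (\<lambda>x. V x ^ k)"
proof (cases "k = 0")
  case False
  then have "V x powr real k = V x ^ k" "expectation V powr real k = expectation V ^ k" for x
    using V by (auto intro!: powr_of_nat integral_nonneg_AE)
  then show ?thesis
    using powr_expectation_le[of V "real k"] V Vk False by simp
qed (simp add: prob_space)

lemma abs_diff_power_le:
  fixes x y :: real
  shows "\<bar>x - y\<bar> ^ k \<le> 2 ^ k * (\<bar>x\<bar> ^ k + \<bar>y\<bar> ^ k)"
proof -
  have "\<bar>x - y\<bar> ^ k \<le> (2 * max \<bar>x\<bar> \<bar>y\<bar>) ^ k"
    by (intro power_mono) auto
  also have "\<dots> = 2 ^ k * max \<bar>x\<bar> \<bar>y\<bar> ^ k"
    by (simp add: power_mult_distrib)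
  also have "\<dots> \<le> 2 ^ k * (\<bar>x\<bar> ^ k + \<bar>y\<bar> ^ k)"
    by (intro mult_left_mono) (auto simp: max_def)
  finally show ?thesis .
qed

section \<open>Moments of a centred variable and of its symmetrization\<close>

context prob_space
begin

context
  fixes Z :: "'a \<Rightarrow> real"
  assumes measZ [measurable]: "Z \<in> borel_measurable M"
    and int: "\<And>k. integrable M (\<lambda>x. Z x ^ k)"
begin

lemma integrable_abs_power: "integrable M (\<lambda>x. \<bar>Z x\<bar> ^ k)"
  using integrable_abs[OF int[of k]] by (simp add: power_abs)

text \<open>\<open>abs_diff_power_le\<close> costs \<open>2 ^ k\<close>, and both coordinates
  contribute the same moment of \<open>Z\<close>, whence one more factor 2.\<close>

lemma symmetrization_abs_power_le:
  shows integrable_symmetrization_abs_power: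
      "integrable (M \<Otimes>\<^sub>M M) (\<lambda>z. \<bar>symmetrization Z z\<bar> ^ k)"
    and "(\<integral>z. \<bar>symmetrization Z z\<bar> ^ k \<partial>(M \<Otimes>\<^sub>M M)) \<le> 2 ^ Suc k * expectation (\<lambda>x. \<bar>Z x\<bar> ^ k)"
proof -
  interpret MM: pair_prob_space M M ..
  let ?f = "\<lambda>z. \<bar>Z (fst z)\<bar> ^ k"
  have int1: "integrable (M \<Otimes>\<^sub>M M) ?f"
  proof -
    have "integrable (distr (M \<Otimes>\<^sub>M M) M fst) (\<lambda>x. \<bar>Z x\<bar> ^ k)"
      unfolding distr_pair_fst by (rule integrable_abs_power)
    then show ?thesis
      by (subst (asm) integrable_distr_eq) auto
  qed
  have E1: "(\<integral>z. ?f z \<partial>(M \<Otimes>\<^sub>M M)) = expectation (\<lambda>x. \<bar>Z x\<bar> ^ k)"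
    using MM.integral_fst'[OF int1] by (simp add: prob_space)
  have int2: "integrable (M \<Otimes>\<^sub>M M) (\<lambda>z. \<bar>Z (snd z)\<bar> ^ k)"
    using MM.integrable_product_swap[OF int1] by (simp add: case_prod_beta')
  have E2: "(\<integral>z. \<bar>Z (snd z)\<bar> ^ k \<partial>(M \<Otimes>\<^sub>M M)) = expectation (\<lambda>x. \<bar>Z x\<bar> ^ k)"
    using MM.integral_product_swap[of ?f] E1 by (simp add: case_prod_beta')
  have bound: "\<bar>symmetrization Z z\<bar> ^ k \<le> 2 ^ k * (\<bar>Z (fst z)\<bar> ^ k + \<bar>Z (snd z)\<bar> ^ k)" for z
    unfolding symmetrization_def case_prod_beta by (rule abs_diff_power_le)
  have int3: "integrable (M \<Otimes>\<^sub>M M) (\<lambda>z. 2 ^ k * (\<bar>Z (fst z)\<bar> ^ k + \<bar>Z (snd z)\<bar> ^ k))"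
    using int1 int2 by simp
  show int4: "integrable (M \<Otimes>\<^sub>M M) (\<lambda>z. \<bar>symmetrization Z z\<bar> ^ k)"
    using bound by (intro Bochner_Integration.integrable_bound[OF int3]) auto
  have "(\<integral>z. \<bar>symmetrization Z z\<bar> ^ k \<partial>(M \<Otimes>\<^sub>M M))
      \<le> (\<integral>z. 2 ^ k * (\<bar>Z (fst z)\<bar> ^ k + \<bar>Z (snd z)\<bar> ^ k) \<partial>(M \<Otimes>\<^sub>M M))"
    by (intro integral_mono int3 int4 bound)
  also have "\<dots> = 2 ^ Suc k * expectation (\<lambda>x. \<bar>Z x\<bar> ^ k)"
    using int1 int2 by (simp add: E1 E2)
  finally show "(\<integral>z. \<bar>symmetrization Z z\<bar> ^ k \<partial>(M \<Otimes>\<^sub>M M)) \<le> 2 ^ Suc k * expectation (\<lambda>x. \<bar>Z x\<bar> ^ k)" .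
qed

lemma integrable_symmetrization_power: "integrable (M \<Otimes>\<^sub>M M) (\<lambda>z. symmetrization Z z ^ k)"
  by (rule Bochner_Integration.integrable_bound[OF integrable_symmetrization_abs_power[of k]])
    (auto simp: power_abs)

text \<open>Exchanging the coordinates preserves the product measure and flips the sign.\<close>

lemma symmetrization_odd_moment:
  assumes "odd k"
  shows "(\<integral>z. symmetrization Z z ^ k \<partial>(M \<Otimes>\<^sub>M M)) = 0"
proof -
  interpret MM: pair_prob_space M M ..
  have "(\<lambda>(x, y). symmetrization Z (y, x) ^ k) = (\<lambda>z. - (symmetrization Z z ^ k))"
  proof
    fix z
    show "(\<lambda>(x, y). symmetrization Z (y, x) ^ k) z = - (symmetrization Z z ^ k)"
      using power_minus_odd[OF assms, of "Z (fst z) - Z (snd z)"]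
      by (simp add: symmetrization_def case_prod_beta)
  qed
  then have "- (\<integral>z. symmetrization Z z ^ k \<partial>(M \<Otimes>\<^sub>M M)) = (\<integral>z. symmetrization Z z ^ k \<partial>(M \<Otimes>\<^sub>M M))"
    using MM.integral_product_swap[of "\<lambda>z. symmetrization Z z ^ k"] by simp
  then show ?thesis
    by simp
qed

text \<open>Since \<open>Z\<close> is centred, a constant \<open>c\<close> is the mean of
  \<open>c - Z y\<close>, so Jensen's inequality bounds \<open>\<bar>c\<bar> ^ k\<close> by the mean
  of \<open>\<bar>c - Z y\<bar> ^ k\<close>. Then \<open>c = Z x\<close> is integrated over
  \<open>x\<close>.\<close>

lemma abs_power_le_symmetrization:
  assumes mean: "expectation Z = 0"
  shows "expectation (\<lambda>x. \<bar>Z x\<bar> ^ k) \<le> (\<integral>z. \<bar>symmetrization Z z\<bar> ^ k \<partial>(M \<Otimes>\<^sub>M M))"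
proof -
  interpret MM: pair_prob_space M M ..
  have intZ: "integrable M Z"
    using int[of 1] by simp
  have int_shift: "integrable M (\<lambda>y. \<bar>c - Z y\<bar> ^ k)" for c
  proof (rule Bochner_Integration.integrable_bound)
    show "integrable M (\<lambda>y. 2 ^ k * (\<bar>c\<bar> ^ k + \<bar>Z y\<bar> ^ k))"
      using integrable_abs_power by simp
    show "AE y in M. norm (\<bar>c - Z y\<bar> ^ k) \<le> norm (2 ^ k * (\<bar>c\<bar> ^ k + \<bar>Z y\<bar> ^ k))"
      using abs_diff_power_le[of c "Z _" k] by auto
  qed auto
  have "\<bar>c\<bar> ^ k \<le> expectation (\<lambda>y. \<bar>c - Z y\<bar> ^ k)" for c
  proof -
    have "\<bar>c\<bar> = \<bar>expectation (\<lambda>y. c - Z y)\<bar>"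
      using intZ mean by (simp add: prob_space)
    also have "\<dots> \<le> expectation (\<lambda>y. \<bar>c - Z y\<bar>)"
      by (rule integral_abs_bound)
    finally have "\<bar>c\<bar> ^ k \<le> expectation (\<lambda>y. \<bar>c - Z y\<bar>) ^ k"
      by (intro power_mono) auto
    also have "\<dots> \<le> expectation (\<lambda>y. \<bar>c - Z y\<bar> ^ k)"
      using intZ int_shift by (intro power_expectation_le) auto
    finally show ?thesis .
  qed
  then have "expectation (\<lambda>x. \<bar>Z x\<bar> ^ k) \<le> expectation (\<lambda>x. expectation (\<lambda>y. \<bar>Z x - Z y\<bar> ^ k))"
    using MM.integrable_fst'[OF integrable_symmetrization_abs_power[of k]]
    by (intro integral_mono integrable_abs_power) (auto simp: symmetrization_def)
  also have "\<dots> = (\<integral>z. \<bar>symmetrization Z z\<bar> ^ k \<partial>(M \<Otimes>\<^sub>M M))"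
    using MM.integral_fst'[OF integrable_symmetrization_abs_power[of k]] by (simp add: symmetrization_def)
  finally show ?thesis .
qed

text \<open>Symmetrizing multiplies the moment of order \<open>2 * k\<close> by at most
  \<open>2 ^ Suc (2 * k) \<le> 4 ^ (2 * k)\<close>, so the doubling constant becomes
  \<open>4 * \<alpha>\<close>. With \<epsilon> equal to \<open>1 / (12 * \<alpha>)\<close> the
  smallness condition reads 8/9 \<le> 1.\<close>

lemma hypercontractive_symmetrization:
  assumes mean: "expectation Z = 0" and "0 < \<alpha>"
    and double: "\<And>k. 1 \<le> k \<Longrightarrow>
      expectation (\<lambda>x. Z x ^ (2 * k)) \<le> \<alpha> ^ (2 * k) * (expectation (\<lambda>x. \<bar>Z x\<bar> ^ k))\<^sup>2"
    and p: "even p"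
  shows "hypercontractive (1 / (12 * \<alpha>)) p (M \<Otimes>\<^sub>M M) (symmetrization Z)"
proof -
  interpret MM: pair_prob_space M M ..
  show ?thesis
  proof (rule MM.hypercontractive_symmetric[where B = "4 * \<alpha>"])
    fix k :: nat assume k: "1 \<le> k"
    let ?W = "\<lambda>z. symmetrization Z z"
    have "(\<integral>z. ?W z ^ (2 * k) \<partial>(M \<Otimes>\<^sub>M M)) \<le> 2 ^ Suc (2 * k) * expectation (\<lambda>x. Z x ^ (2 * k))"
      using symmetrization_abs_power_le(2)[of "2 * k"] by (simp add: power_even_abs)
    also have "\<dots> \<le> 4 ^ (2 * k) * (\<alpha> ^ (2 * k) * (expectation (\<lambda>x. \<bar>Z x\<bar> ^ k))\<^sup>2)"
    proof (intro mult_mono double k)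
      have "(2 :: real) ^ Suc (2 * k) \<le> 2 ^ (2 * (2 * k))"
        using k by (intro power_increasing) auto
      then show "(2 :: real) ^ Suc (2 * k) \<le> 4 ^ (2 * k)"
        by (simp only: power_mult) simp
    qed (auto intro!: integral_nonneg_AE simp: zero_le_even_power)
    also have "\<dots> \<le> 4 ^ (2 * k) * (\<alpha> ^ (2 * k) * (\<integral>z. \<bar>?W z\<bar> ^ k \<partial>(M \<Otimes>\<^sub>M M))\<^sup>2)"
      by (intro mult_left_mono power_mono abs_power_le_symmetrization mean integral_nonneg_AE)
        (use \<open>0 < \<alpha>\<close> in auto)
    finally show "(\<integral>z. ?W z ^ (2 * k) \<partial>(M \<Otimes>\<^sub>M M)) \<le> (4 * \<alpha>) ^ (2 * k) * (\<integral>z. \<bar>?W z\<bar> ^ k \<partial>(M \<Otimes>\<^sub>M M))\<^sup>2"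
      by (simp add: power_mult_distrib)
  next
    show "8 * (1 / (12 * \<alpha>) * (4 * \<alpha>))\<^sup>2 \<le> 1"
      using \<open>0 < \<alpha>\<close> by (simp add: power2_eq_square field_simps)
  qed (use p in \<open>auto intro: integrable_symmetrization_power symmetrization_odd_moment\<close>)
qed

text \<open>The shift 0 gives moment doubling for the symmetrization. Passing from \<open>Z\<close>
  to it is free at order \<open>2 * p\<close>; passing back at order \<open>p\<close> costs
  \<open>2 ^ Suc p \<le> 4 ^ p\<close>, whose square is \<open>4 ^ (2 * p)\<close>.\<close>

lemma moment_doubling_of_hypercontractive:
  assumes mean: "expectation Z = 0" and "0 < \<epsilon>"
    and hyp: "hypercontractive \<epsilon> p (M \<Otimes>\<^sub>M M) (symmetrization Z)" and p: "even p" "0 < p"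
  shows "expectation (\<lambda>x. Z x ^ (2 * p)) \<le> (4 / \<epsilon>) ^ (2 * p) * (expectation (\<lambda>x. Z x ^ p))\<^sup>2"
proof -
  interpret MM: pair_prob_space M M ..
  let ?W = "\<lambda>z. symmetrization Z z"
  have abs_even: "\<bar>a\<bar> ^ p = a ^ p" "\<bar>a\<bar> ^ (2 * p) = a ^ (2 * p)" for a :: real
    using p by (auto simp: power_even_abs)
  have nn: "(\<integral>\<^sup>+z. ennreal (?W z ^ n) \<partial>(M \<Otimes>\<^sub>M M)) = ennreal (\<integral>z. ?W z ^ n \<partial>(M \<Otimes>\<^sub>M M))"
    if "even n" for n
    using that by (intro nn_integral_eq_integral integrable_symmetrization_power) (auto simp: zero_le_even_power)
  have "(\<integral>\<^sup>+z. ennreal (\<epsilon> ^ (2 * p) * ?W z ^ (2 * p)) \<partial>(M \<Otimes>\<^sub>M M)) \<le> (\<integral>\<^sup>+z. ennreal (?W z ^ p) \<partial>(M \<Otimes>\<^sub>M M))\<^sup>2"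
    using hyp[unfolded hypercontractive_def, rule_format, of 0] by (simp add: power_mult_distrib)
  also have "(\<integral>\<^sup>+z. ennreal (\<epsilon> ^ (2 * p) * ?W z ^ (2 * p)) \<partial>(M \<Otimes>\<^sub>M M))
      = ennreal (\<epsilon> ^ (2 * p)) * (\<integral>\<^sup>+z. ennreal (?W z ^ (2 * p)) \<partial>(M \<Otimes>\<^sub>M M))"
    using \<open>0 < \<epsilon>\<close> by (simp add: ennreal_mult nn_integral_cmult zero_le_even_power)
  finally have "ennreal (\<epsilon> ^ (2 * p)) * ennreal (\<integral>z. ?W z ^ (2 * p) \<partial>(M \<Otimes>\<^sub>M M)) \<le> (ennreal (\<integral>z. ?W z ^ p \<partial>(M \<Otimes>\<^sub>M M)))\<^sup>2"
    using nn[of p] nn[of "2 * p"] p by simp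
  moreover have Wp: "0 \<le> (\<integral>z. ?W z ^ p \<partial>(M \<Otimes>\<^sub>M M))"
    using p by (intro integral_nonneg_AE) (auto simp: zero_le_even_power)
  ultimately have 1: "\<epsilon> ^ (2 * p) * (\<integral>z. ?W z ^ (2 * p) \<partial>(M \<Otimes>\<^sub>M M)) \<le> (\<integral>z. ?W z ^ p \<partial>(M \<Otimes>\<^sub>M M))\<^sup>2"
    using \<open>0 < \<epsilon>\<close> by (simp add: ennreal_power zero_le_even_power flip: ennreal_mult')
  have 2: "(\<integral>z. ?W z ^ p \<partial>(M \<Otimes>\<^sub>M M)) \<le> 4 ^ p * expectation (\<lambda>x. Z x ^ p)"
  proof -
    have "(\<integral>z. ?W z ^ p \<partial>(M \<Otimes>\<^sub>M M)) \<le> 2 ^ Suc p * expectation (\<lambda>x. Z x ^ p)"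
      using symmetrization_abs_power_le(2)[of p] by (simp add: abs_even)
    also have "\<dots> \<le> 4 ^ p * expectation (\<lambda>x. Z x ^ p)"
    proof (rule mult_right_mono)
      have "(2 :: real) ^ Suc p \<le> 2 ^ (2 * p)"
        using p by (intro power_increasing) auto
      then show "(2 :: real) ^ Suc p \<le> 4 ^ p"
        by (simp only: power_mult) simp
    qed (use p in \<open>auto intro!: integral_nonneg_AE simp: zero_le_even_power\<close>)
    finally show ?thesis .
  qed
  have "\<epsilon> ^ (2 * p) * expectation (\<lambda>x. Z x ^ (2 * p)) \<le> \<epsilon> ^ (2 * p) * (\<integral>z. ?W z ^ (2 * p) \<partial>(M \<Otimes>\<^sub>M M))"
    using abs_power_le_symmetrization[OF mean, of "2 * p"] \<open>0 < \<epsilon>\<close>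
    by (intro mult_left_mono) (auto simp: abs_even)
  also have "\<dots> \<le> (4 ^ p * expectation (\<lambda>x. Z x ^ p))\<^sup>2"
    using 1 2 Wp by (meson order_trans power_mono)
  finally show ?thesis
    using \<open>0 < \<epsilon>\<close> by (simp add: power_mult_distrib power_divide field_simps flip: power_mult)
qed

end

end

section \<open>Moment doubling for sums of independent variables\<close>

lemma (in prob_space) integrable_power_sum:
  fixes X :: "'i \<Rightarrow> 'a \<Rightarrow> real"
  assumes "finite I"
    and "\<And>i. i \<in> I \<Longrightarrow> X i \<in> borel_measurable M"
    and "\<And>i k. i \<in> I \<Longrightarrow> integrable M (\<lambda>x. X i x ^ k)"
  shows "integrable M (\<lambda>x. (\<Sum>i\<in>I. X i x) ^ k)"
  using assms
proof (induction I arbitrary: k)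
  case (insert i I)
  note [measurable] = insert.prems(1)
  have [measurable]: "X i \<in> borel_measurable M" "(\<lambda>x. \<Sum>i\<in>I. X i x) \<in> borel_measurable M"
    using insert by auto
  show ?case
  proof (rule Bochner_Integration.integrable_bound)
    have "integrable M (\<lambda>x. \<bar>X i x ^ k\<bar>)" "integrable M (\<lambda>x. \<bar>(\<Sum>i\<in>I. X i x) ^ k\<bar>)"
      using insert by (auto intro!: integrable_abs)
    then show "integrable M (\<lambda>x. 2 ^ k * (\<bar>X i x\<bar> ^ k + \<bar>- (\<Sum>i\<in>I. X i x)\<bar> ^ k))"
      by (simp add: power_abs)
    show "AE x in M. norm ((\<Sum>i\<in>insert i I. X i x) ^ k) \<le> norm (2 ^ k * (\<bar>X i x\<bar> ^ k + \<bar>- (\<Sum>i\<in>I. X i x)\<bar> ^ k))"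
      using abs_diff_power_le[of "X i _" "- (\<Sum>i\<in>I. X i _)" k] insert by (auto simp: power_abs)
  qed (use insert in simp)
qed simp

text \<open>The constant is \<open>4 / \<epsilon>\<close> with \<epsilon> equal to
  \<open>1 / (12 * \<alpha>)\<close>; it depends neither on \<open>p\<close> nor on the number of
  summands.\<close>

lemma (in prob_space) sum_moment_doubling:
  fixes X :: "'i \<Rightarrow> 'a \<Rightarrow> real"
  assumes I: "finite I" and indep: "indep_vars (\<lambda>_. borel) X I" and "0 < \<alpha>"
    and int: "\<And>i k. i \<in> I \<Longrightarrow> integrable M (\<lambda>x. X i x ^ k)"
    and mean: "\<And>i. i \<in> I \<Longrightarrow> expectation (X i) = 0"
    and double: "\<And>i k. i \<in> I \<Longrightarrow> 1 \<le> k \<Longrightarrow>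
      expectation (\<lambda>x. X i x ^ (2 * k)) \<le> \<alpha> ^ (2 * k) * (expectation (\<lambda>x. \<bar>X i x\<bar> ^ k))\<^sup>2"
    and p: "even p" "0 < p"
  shows "expectation (\<lambda>x. (\<Sum>i\<in>I. X i x) ^ (2 * p))
    \<le> (48 * \<alpha>) ^ (2 * p) * (expectation (\<lambda>x. (\<Sum>i\<in>I. X i x) ^ p))\<^sup>2"
proof -
  have meas: "X i \<in> borel_measurable M" if "i \<in> I" for i
    using indep that unfolding indep_vars_def by auto
  have "hypercontractive (1 / (12 * \<alpha>)) p (M \<Otimes>\<^sub>M M) (symmetrization (\<lambda>x. \<Sum>i\<in>I. X i x))"
    using I indep p \<open>0 < \<alpha>\<close> meas int mean double
    by (intro hypercontractive_indep_sum hypercontractive_symmetrization) auto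
  moreover have "expectation (\<lambda>x. \<Sum>i\<in>I. X i x) = 0"
    using int[of _ 1] mean by (simp add: Bochner_Integration.integral_sum)
  moreover have "(\<lambda>x. \<Sum>i\<in>I. X i x) \<in> borel_measurable M"
    using meas by measurable
  ultimately show ?thesis
    using moment_doubling_of_hypercontractive[of "\<lambda>x. \<Sum>i\<in>I. X i x" "1 / (12 * \<alpha>)" p]
      integrable_power_sum[OF I meas int] p \<open>0 < \<alpha>\<close> by simp
qed

section \<open>Dyadic moments, truncation and tails\<close>

lemma ex_power2_bracket:
  fixes p :: real
  assumes "1 \<le> p"
  obtains k :: nat where "2 ^ k \<le> p" "p < 2 ^ Suc k"
proof -
  obtain n :: nat where "p < 2 ^ n"
    using real_arch_pow[of 2 p] by auto
  then obtain n where n: "p < 2 ^ n" "\<And>m. m < n \<Longrightarrow> \<not> p < 2 ^ m"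
    using exists_least_iff[of "\<lambda>n. p < 2 ^ n"] by auto
  with assms obtain k where "n = Suc k"
    by (cases n) auto
  with n that show thesis
    by (metis lessI not_less)
qed

context prob_space
begin

context
  fixes Z :: "'a \<Rightarrow> real" and \<beta> :: real
  assumes measZ' [measurable]: "Z \<in> borel_measurable M"
    and int: "\<And>k. integrable M (\<lambda>x. Z x ^ k)"
begin

lemma integrable_abs_powr:
  assumes "1 \<le> p"
  shows "integrable M (\<lambda>x. \<bar>Z x\<bar> powr p)"
proof -
  obtain n :: nat where n: "p \<le> real n"
    using real_arch_simple by blast
  show ?thesis
  proof (rule Bochner_Integration.integrable_bound)
    show "integrable M (\<lambda>x. 1 + \<bar>Z x\<bar> ^ n)"
      using integrable_abs_power[OF measZ' int] by simp
    have "a powr p \<le> 1 + a ^ n" if "0 \<le> a" for a :: real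
    proof (cases "a \<le> 1")
      case True
      then have "a powr p \<le> 1"
        using that assms powr_mono2[of p a 1] by simp
      then show ?thesis
        using that by (simp add: add_increasing2)
    next
      case False
      then have "a powr p \<le> a powr real n"
        using n by (intro powr_mono) auto
      then show ?thesis
        using False by (simp add: powr_realpow)
    qed
    then show "AE x in M. norm (\<bar>Z x\<bar> powr p) \<le> norm (1 + \<bar>Z x\<bar> ^ n)"
      by auto
  qed auto
qed

lemma Lp_norm_eq:
  assumes "1 \<le> p"
  shows "Lp_norm M p Z = ennreal (expectation (\<lambda>x. \<bar>Z x\<bar> powr p) powr (1 / p))"
  using nn_integral_eq_integral[OF integrable_abs_powr[OF assms]]
  by (simp add: Lp_norm_def integral_nonneg_AE)

lemma Lp_norm_le_iff:
  assumes p: "1 \<le> p" and v: "0 \<le> v"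
  shows "Lp_norm M p Z \<le> ennreal v \<longleftrightarrow> expectation (\<lambda>x. \<bar>Z x\<bar> powr p) \<le> v powr p"
proof -
  let ?I = "expectation (\<lambda>x. \<bar>Z x\<bar> powr p)"
  have I: "0 \<le> ?I"
    by (simp add: integral_nonneg_AE)
  have "?I powr (1 / p) \<le> v \<longleftrightarrow> (?I powr (1 / p)) powr p \<le> v powr p"
    using p v powr_mono2[of p "?I powr (1 / p)" v] powr_less_mono2[of p v "?I powr (1 / p)"]
    by (fastforce simp: not_le)
  then show ?thesis
    using p v I by (simp add: Lp_norm_eq powr_powr)
qed

text \<open>Monotonicity of the norms in the exponent, raised to the power \<open>q\<close>.\<close>

lemma abs_moment_powr_mono:
  assumes "1 \<le> p" "p \<le> q"
  shows "expectation (\<lambda>x. \<bar>Z x\<bar> powr p) powr (q / p) \<le> expectation (\<lambda>x. \<bar>Z x\<bar> powr q)"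
  using powr_expectation_le[of "\<lambda>x. \<bar>Z x\<bar> powr p" "q / p"] assms
    integrable_abs_powr[of p] integrable_abs_powr[of q]
  by (simp add: powr_powr)

lemma dyadic_moment_powr: "\<bar>Z x\<bar> powr (2 ^ k) = \<bar>Z x\<bar> ^ (2 ^ k)"
  using powr_of_nat[of "\<bar>Z x\<bar>" "2 ^ k"] by simp

text \<open>Doubling for sums is available at even exponents only, so the step from exponent 1 to 2
  is recovered from the one from 2 to 4: splitting at a level \<open>s\<close>, large values are
  controlled by the fourth moment and small ones by the first.\<close>

lemma double_moment_first:
  assumes four: "expectation (\<lambda>x. Z x ^ 4) \<le> \<beta> ^ 4 * (expectation (\<lambda>x. Z x ^ 2))\<^sup>2" and \<beta>: "1 \<le> \<beta>"
  shows "expectation (\<lambda>x. Z x ^ 2) \<le> (4 * \<beta>\<^sup>2)\<^sup>2 * (expectation (\<lambda>x. \<bar>Z x\<bar>))\<^sup>2"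
proof -
  define m where "m = expectation (\<lambda>x. Z x ^ 2)"
  define E where "E = expectation (\<lambda>x. \<bar>Z x\<bar>)"
  have m: "0 \<le> m" "0 \<le> E"
    by (simp_all add: m_def E_def integral_nonneg_AE)
  show ?thesis
  proof (cases "m = 0")
    case False
    with m have "0 < m"
      by simp
    \<comment> \<open>The level is chosen so that the fourth-moment term is at most
      \<open>m / 2\<close> and can be absorbed on the left.\<close>
    define s where "s = \<beta>\<^sup>2 * sqrt (2 * m)"
    have s: "0 < s" "s\<^sup>2 = 2 * \<beta> ^ 4 * m"
      using \<open>0 < m\<close> \<beta> by (auto simp: s_def power_mult_distrib)
    have "z\<^sup>2 \<le> s * \<bar>z\<bar> + z ^ 4 / s\<^sup>2" for z :: real
    proof (cases "\<bar>z\<bar> \<le> s")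
      case True
      then have "z\<^sup>2 \<le> s * \<bar>z\<bar>"
        using mult_right_mono[of "\<bar>z\<bar>" s "\<bar>z\<bar>"] by (simp add: power2_eq_square)
      moreover have "0 \<le> z ^ 4 / s\<^sup>2"
        by (intro divide_nonneg_nonneg) (auto simp: zero_le_even_power)
      ultimately show ?thesis
        by linarith
    next
      case False
      then have "s\<^sup>2 \<le> z\<^sup>2"
        using s by (metis abs_le_square_iff abs_of_pos nle_le)
      then have "z\<^sup>2 * s\<^sup>2 \<le> z\<^sup>2 * z\<^sup>2"
        by (intro mult_left_mono) auto
      then have "z\<^sup>2 \<le> z ^ 4 / s\<^sup>2"
        using s(1) by (simp add: pos_le_divide_eq flip: power_add)
      moreover have "0 \<le> s * \<bar>z\<bar>"
        using s by simp
      ultimately show ?thesis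
        by linarith
    qed
    then have "m \<le> expectation (\<lambda>x. s * \<bar>Z x\<bar> + Z x ^ 4 / s\<^sup>2)"
      unfolding m_def using int int[of 1] by (intro integral_mono) auto
    also have "\<dots> = s * E + expectation (\<lambda>x. Z x ^ 4) / s\<^sup>2"
      unfolding E_def using int[of 4] int[of 1] by simp
    also have "\<dots> \<le> s * E + \<beta> ^ 4 * m\<^sup>2 / s\<^sup>2"
      using four unfolding m_def by (intro add_left_mono divide_right_mono) auto
    also have "\<beta> ^ 4 * m\<^sup>2 / s\<^sup>2 = m / 2"
      unfolding s using \<open>0 < m\<close> \<beta> by (simp add: power2_eq_square)
    finally have "m \<le> 2 * s * E"
      by simp
    then have "m\<^sup>2 \<le> (2 * s * E)\<^sup>2"
      using m by (intro power_mono) auto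
    then have "m * m \<le> m * (8 * \<beta> ^ 4 * E\<^sup>2)"
      by (simp add: power_mult_distrib s power2_eq_square[of m] mult_ac)
    then have "m \<le> 8 * \<beta> ^ 4 * E\<^sup>2"
      using \<open>0 < m\<close> by (rule mult_left_le_imp_le)
    also have "\<dots> \<le> 16 * \<beta> ^ 4 * E\<^sup>2"
      using \<beta> by (intro mult_right_mono) auto
    also have "\<dots> = (4 * \<beta>\<^sup>2)\<^sup>2 * E\<^sup>2"
      by (simp add: power_mult_distrib)
    finally show ?thesis
      unfolding m_def E_def .
  qed (simp add: m_def)
qed

context
  assumes \<beta>: "1 \<le> \<beta>"
    and double: "\<And>j. expectation (\<lambda>x. \<bar>Z x\<bar> ^ 2 ^ Suc j) \<le> \<beta> ^ 2 ^ Suc j * (expectation (\<lambda>x. \<bar>Z x\<bar> ^ 2 ^ j))\<^sup>2"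
begin

text \<open>In terms of norms, each of the \<open>k\<close> doublings costs one factor
  \<beta>.\<close>

lemma iterated_moment_doubling:
  "expectation (\<lambda>x. \<bar>Z x\<bar> ^ 2 ^ (j + k)) \<le> (\<beta> ^ k) ^ 2 ^ (j + k) * expectation (\<lambda>x. \<bar>Z x\<bar> ^ 2 ^ j) ^ 2 ^ k"
proof (induction k)
  case (Suc k)
  let ?N = "\<lambda>j. expectation (\<lambda>x. \<bar>Z x\<bar> ^ 2 ^ j)"
  have "?N (j + Suc k) \<le> \<beta> ^ 2 ^ Suc (j + k) * (?N (j + k))\<^sup>2"
    using double[of "j + k"] by simp
  also have "\<dots> \<le> \<beta> ^ 2 ^ Suc (j + k) * ((\<beta> ^ k) ^ 2 ^ (j + k) * ?N j ^ 2 ^ k)\<^sup>2"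
    using \<beta> Suc by (intro mult_left_mono power_mono) (auto simp: integral_nonneg_AE)
  also have "\<dots> = (\<beta> ^ Suc k) ^ 2 ^ (j + Suc k) * ?N j ^ 2 ^ Suc k"
    by (simp add: power_mult_distrib mult_ac flip: power_mult)
  finally show ?case .
qed simp

text \<open>The truncated first moment is dominated by the moment of order \<open>2 ^ (k + 2)\<close>, where
  \<open>2 ^ k\<close> is the largest dyadic exponent below \<open>p\<close>; two doublings bound that moment.\<close>

lemma truncated_moment_le:
  assumes p: "1 \<le> p" and v: "0 < v" and norm: "Lp_norm M p Z \<le> ennreal v"
    and u: "u = exp 1 * \<beta>\<^sup>2 * v"
  shows "(\<integral>\<^sup>+x. ennreal \<bar>Z x\<bar> * indicator {x. u \<le> \<bar>Z x\<bar>} x \<partial>M) \<le> ennreal (u * exp (- (2 * p)))"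
proof -
  obtain k :: nat where k: "2 ^ k \<le> p" "p < 2 ^ Suc k"
    using ex_power2_bracket[OF p] .
  let ?N = "\<lambda>j. expectation (\<lambda>x. \<bar>Z x\<bar> ^ 2 ^ j)"
  define q :: nat where "q = 2 ^ (k + 2)"
  have u0: "0 < u"
    using \<beta> v by (simp add: u)
  \<comment> \<open>The norm of order \<open>2 ^ k \<le> p\<close> is at most the norm of order
    \<open>p\<close>; the roots are avoided by contradiction.\<close>
  have Nk: "?N k \<le> v ^ 2 ^ k"
  proof (rule ccontr)
    assume "\<not> ?N k \<le> v ^ 2 ^ k"
    then have "(v ^ 2 ^ k) powr (p / 2 ^ k) < ?N k powr (p / 2 ^ k)"
      using p v by (intro powr_less_mono2) auto
    moreover have "(v ^ 2 ^ k) powr (p / 2 ^ k) = v powr p"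
      using v by (simp add: powr_powr flip: powr_realpow)
    moreover have "?N k powr (p / 2 ^ k) \<le> expectation (\<lambda>x. \<bar>Z x\<bar> powr p)"
      using abs_moment_powr_mono[of "2 ^ k" p] k by (simp add: dyadic_moment_powr)
    moreover have "expectation (\<lambda>x. \<bar>Z x\<bar> powr p) \<le> v powr p"
      using Lp_norm_le_iff[OF p] v norm by simp
    ultimately show False
      by linarith
  qed
  have "?N (k + 2) \<le> (\<beta>\<^sup>2) ^ q * ?N k ^ 2\<^sup>2"
    using iterated_moment_doubling[of k 2] by (simp add: q_def)
  also have "\<dots> \<le> (\<beta>\<^sup>2) ^ q * (v ^ 2 ^ k) ^ 2\<^sup>2"
    using Nk \<beta> by (intro mult_left_mono power_mono) (auto simp: integral_nonneg_AE)
  also have "\<dots> = (\<beta>\<^sup>2 * v) ^ q"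
    by (simp add: q_def power_mult_distrib power_add mult.commute flip: power_mult)
  finally have Nq: "expectation (\<lambda>x. \<bar>Z x\<bar> ^ q) \<le> (\<beta>\<^sup>2 * v) ^ q"
    by (simp add: q_def)
  \<comment> \<open>Where \<open>u \<le> \<bar>z\<bar>\<close> the quotient
    \<open>\<bar>z\<bar> / u\<close> is at least 1, so raising it to the power \<open>q\<close> only
    increases it.\<close>
  have ptw: "ennreal \<bar>z\<bar> * indicator {x. u \<le> \<bar>Z x\<bar>} x \<le> ennreal (u * (\<bar>z\<bar> / u) ^ q)" if "z = Z x" for z x
  proof (cases "u \<le> \<bar>z\<bar>")
    case True
    have "(\<bar>z\<bar> / u) ^ 1 \<le> (\<bar>z\<bar> / u) ^ q"
      using True u0 by (intro power_increasing) (auto simp: q_def)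
    then show ?thesis
      using True u0 that by (simp add: field_simps)
  qed (use that in simp)
  have "(\<integral>\<^sup>+x. ennreal \<bar>Z x\<bar> * indicator {x. u \<le> \<bar>Z x\<bar>} x \<partial>M) \<le> (\<integral>\<^sup>+x. ennreal (u * (\<bar>Z x\<bar> / u) ^ q) \<partial>M)"
    by (intro nn_integral_mono ptw) simp
  also have "\<dots> = ennreal (u * (expectation (\<lambda>x. \<bar>Z x\<bar> ^ q) / u ^ q))"
    using u0 integrable_abs_power[OF measZ' int] by (subst nn_integral_eq_integral) (auto simp: power_divide)
  also have "\<dots> \<le> ennreal (u * ((\<beta>\<^sup>2 * v) ^ q / u ^ q))"
    using u0 Nq by (intro ennreal_leI mult_left_mono divide_right_mono) auto
  \<comment> \<open>The factor \<open>exp 1\<close> in \<open>u\<close> produces the decay, and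
    \<open>q = 4 * 2 ^ k\<close> exceeds \<open>2 * p\<close>.\<close>
  also have "(\<beta>\<^sup>2 * v) ^ q / u ^ q = exp (- real q)"
    using \<beta> v by (simp add: u mult.assoc power_mult_distrib exp_minus divide_inverse exp_of_nat_mult[symmetric] power_mult_distrib[of "exp 1"])
      (simp add: field_simps exp_of_nat_mult[of q 1, simplified, symmetric])
  also have "ennreal (u * exp (- real q)) \<le> ennreal (u * exp (- (2 * p)))"
    using u0 k by (intro ennreal_leI mult_left_mono) (auto simp: q_def)
  finally show ?thesis .
qed

text \<open>Let \<open>2 ^ k\<close> be dyadic between \<open>p\<close> and \<open>2 * p\<close>. If
  \<open>k \<le> K\<close>, doubling starts from the first moment. Otherwise it starts from
  \<open>r = 2 ^ (k - K)\<close>: there the tail bound and Cauchy-Schwarz leave at most half of the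
  moment on the event \<open>A \<le> \<bar>Z x\<bar>\<close>, so the moment is at most
  \<open>2 * A ^ r\<close>. Only \<open>K\<close> doublings remain.\<close>

lemma Lp_norm_log_le:
  assumes A: "0 < A" and i: "1 \<le> i" and mean_le: "expectation (\<lambda>x. \<bar>Z x\<bar>) \<le> A"
    and tail: "prob {x \<in> space M. A \<le> \<bar>Z x\<bar>} \<le> 2 / real i"
    and K: "3 \<le> K" "8 * ln \<beta> \<le> 2 ^ K"
  shows "Lp_norm M (ln (exp 1 + real i)) Z \<le> ennreal (2 * \<beta> ^ K * A)"
proof -
  define p where "p = ln (exp 1 + real i)"
  have exp_p: "exp p = exp 1 + real i"
    unfolding p_def by (intro exp_ln add_pos_nonneg) auto
  have p: "1 \<le> p"
    using exp_p by (smt (verit) exp_le_cancel_iff of_nat_0_le_iff)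
  obtain m :: nat where m: "2 ^ m \<le> p" "p < 2 ^ Suc m"
    using ex_power2_bracket[OF p] .
  define k where "k = Suc m"
  have k: "p \<le> 2 ^ k" "2 ^ k \<le> 2 * p"
    using m by (auto simp: k_def)
  let ?N = "\<lambda>j. expectation (\<lambda>x. \<bar>Z x\<bar> ^ 2 ^ j)"
  have N0: "0 \<le> ?N j" for j
    by (simp add: integral_nonneg_AE)
  have Nk: "?N k \<le> (2 * \<beta> ^ K * A) ^ 2 ^ k"
  proof (cases "k \<le> K")
    case True
    have "?N k \<le> (\<beta> ^ k) ^ 2 ^ k * expectation (\<lambda>x. \<bar>Z x\<bar>) ^ 2 ^ k"
      using iterated_moment_doubling[of 0 k] by simp
    also have "\<dots> \<le> (\<beta> ^ k) ^ 2 ^ k * A ^ 2 ^ k"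
      using \<beta> mean_le by (intro mult_left_mono power_mono) (auto simp: integral_nonneg_AE)
    also have "\<dots> = (\<beta> ^ k * A) ^ 2 ^ k"
      by (simp add: power_mult_distrib)
    also have "\<dots> \<le> (2 * \<beta> ^ K * A) ^ 2 ^ k"
    proof (intro power_mono mult_right_mono)
      have "\<beta> ^ k \<le> \<beta> ^ K" "0 \<le> \<beta> ^ K"
        using True \<beta> by (auto intro: power_increasing)
      then show "\<beta> ^ k \<le> 2 * \<beta> ^ K"
        by linarith
    qed (use A \<beta> in auto)
    finally show ?thesis .
  next
    case False
    define j where "j = k - K"
    have kj: "k = j + K"
      using False by (simp add: j_def)
    define r :: nat where "r = 2 ^ j"
    have r_eq: "real r * 2 ^ K = 2 ^ k"
      by (simp add: r_def kj power_add)
    \<comment> \<open>This is the square root of \<open>exp 1 + real i\<close>. It dominates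
      \<open>\<beta> ^ (2 * r)\<close> because
      \<open>8 * r * ln \<beta> \<le> 2 ^ k \<le> 2 * p\<close>.\<close>
    define y where "y = exp (p / 2)"
    have y2: "y\<^sup>2 = exp 1 + real i"
      by (simp add: y_def power2_eq_square flip: exp_add exp_p)
    \<comment> \<open>Being in the second case with \<open>3 \<le> K\<close> forces
      \<open>8 \<le> p\<close>, hence \<open>16 \<le> y\<close>, which makes \<open>y\<close> small
      compared with \<open>i\<close>.\<close>
    have "2 ^ K \<le> (2 :: real) ^ m"
      using False by (intro power_increasing) (auto simp: k_def)
    moreover have "(8 :: real) \<le> 2 ^ K"
      using K power_increasing[of 3 K "2 :: real"] by simp
    ultimately have "8 \<le> p"
      using m(1) by linarith
    then have "exp (of_nat 4 * 1) \<le> y"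
      unfolding y_def by simp
    moreover have "(2 :: real) ^ 4 \<le> exp 1 ^ 4"
      using exp_ge_add_one_self[of 1] by (intro power_mono) auto
    ultimately have "16 \<le> y"
      unfolding exp_of_nat_mult by simp
    then have "16 * y \<le> y\<^sup>2"
      by (simp add: power2_eq_square)
    then have y_le: "8 * y \<le> real i"
      using y2 exp_le \<open>16 \<le> y\<close> by simp
    have "\<beta> ^ (2 * r) = exp (2 * real r * ln \<beta>)"
      using \<beta> by (simp add: powr_def flip: powr_realpow)
    also have "\<dots> \<le> y"
    proof -
      have "real r * (8 * ln \<beta>) \<le> real r * 2 ^ K"
        using K by (intro mult_left_mono) auto
      then show ?thesis
        unfolding y_def r_eq using k by simp
    qed
    finally have b2r: "\<beta> ^ (2 * r) * 8 \<le> real i"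
      using y_le by simp
    define B where "B = {x \<in> space M. A \<le> \<bar>Z x\<bar>}"
    have [measurable]: "B \<in> sets M"
      unfolding B_def by measurable
    have ind_sq: "(indicator B x)\<^sup>2 = (indicator B x :: real)" for x
      by (simp add: indicator_def)
    have int_B: "integrable M (indicator B :: 'a \<Rightarrow> real)"
      by (rule integrable_const_bound[where B = 1]) auto
    have intr: "integrable M (\<lambda>x. \<bar>Z x\<bar> ^ n)" for n
      by (rule integrable_abs_power[OF measZ' int])
    have "(\<integral>x. \<bar>\<bar>Z x\<bar> ^ r * indicator B x\<bar> \<partial>M)\<^sup>2 \<le> (\<integral>x. (\<bar>Z x\<bar> ^ r)\<^sup>2 \<partial>M) * (\<integral>x. (indicator B x)\<^sup>2 \<partial>M)"
      using intr[of "r * 2"] int_B by (intro integral_mult_square_le) (auto simp: power_mult ind_sq)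
    also have "(\<integral>x. (indicator B x)\<^sup>2 \<partial>M) = prob B"
      by (simp add: ind_sq)
    also have "(\<integral>x. (\<bar>Z x\<bar> ^ r)\<^sup>2 \<partial>M) = ?N (Suc j)"
      by (simp add: r_def mult.commute flip: power_mult)
    also have "?N (Suc j) * prob B \<le> (\<beta> ^ (2 * r) * (?N j)\<^sup>2) * (2 / real i)"
      using double[of j] tail \<beta> unfolding B_def by (intro mult_mono) (auto simp: r_def)
    also have "\<dots> = (\<beta> ^ (2 * r) * (2 / real i)) * (?N j)\<^sup>2"
      by simp
    \<comment> \<open>This is where \<open>8 * \<beta> ^ (2 * r) \<le> i\<close> beats the tail
      probability.\<close>
    also have "\<dots> \<le> 1 / 4 * (?N j)\<^sup>2"
      using b2r i by (intro mult_right_mono) (auto simp: field_simps)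
    also have "\<dots> = (?N j / 2)\<^sup>2"
      by (simp add: power_divide)
    finally have "(\<integral>x. \<bar>\<bar>Z x\<bar> ^ r * indicator B x\<bar> \<partial>M) \<le> ?N j / 2"
      by (rule power2_le_imp_le) (use N0[of j] in simp)
    then have half: "(\<integral>x. \<bar>Z x\<bar> ^ r * indicator B x \<partial>M) \<le> ?N j / 2"
      by (simp add: abs_mult)
    have int_rB: "integrable M (\<lambda>x. \<bar>Z x\<bar> ^ r * indicator B x)"
      by (rule integrable_real_mult_indicator[OF \<open>B \<in> sets M\<close> intr])
    have "?N j \<le> expectation (\<lambda>x. A ^ r + \<bar>Z x\<bar> ^ r * indicator B x)"
      unfolding r_def[symmetric]
    proof (rule integral_mono)
      show "\<bar>Z x\<bar> ^ r \<le> A ^ r + \<bar>Z x\<bar> ^ r * indicator B x" if "x \<in> space M" for x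
        using that A by (cases "A \<le> \<bar>Z x\<bar>") (auto simp: B_def intro: power_mono)
    qed (use intr int_rB in auto)
    also have "\<dots> = A ^ r + (\<integral>x. \<bar>Z x\<bar> ^ r * indicator B x \<partial>M)"
      using int_rB by (simp add: prob_space)
    finally have "?N j \<le> 2 * A ^ r"
      using half by linarith
    also have "\<dots> \<le> (2 * A) ^ r"
      using A self_le_power[of "2 :: real" r] by (auto simp: power_mult_distrib r_def intro: mult_right_mono)
    finally have Nj: "?N j \<le> (2 * A) ^ r" .
    have "?N k \<le> (\<beta> ^ K) ^ 2 ^ k * ?N j ^ 2 ^ K"
      unfolding kj by (rule iterated_moment_doubling)
    also have "\<dots> \<le> (\<beta> ^ K) ^ 2 ^ k * ((2 * A) ^ r) ^ 2 ^ K"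
      using \<beta> Nj N0 by (intro mult_left_mono power_mono) auto
    also have "\<dots> = (2 * \<beta> ^ K * A) ^ 2 ^ k"
      by (simp add: r_def kj power_add power_mult_distrib mult_ac flip: power_mult)
    finally show ?thesis .
  qed
  define c where "c = 2 * \<beta> ^ K * A"
  have c: "0 < c"
    using \<beta> A by (simp add: c_def)
  have "expectation (\<lambda>x. \<bar>Z x\<bar> powr p) powr (2 ^ k / p) \<le> ?N k"
    using abs_moment_powr_mono[of p "2 ^ k"] p k by (simp add: dyadic_moment_powr)
  also have "\<dots> \<le> c ^ 2 ^ k"
    using Nk by (simp add: c_def)
  also have "\<dots> = (c powr p) powr (2 ^ k / p)"
    using c p by (simp add: powr_powr flip: powr_realpow)
  finally have "\<not> (c powr p) powr (2 ^ k / p) < expectation (\<lambda>x. \<bar>Z x\<bar> powr p) powr (2 ^ k / p)"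
    by simp
  moreover have "0 < 2 ^ k / p"
    using p by simp
  ultimately have "expectation (\<lambda>x. \<bar>Z x\<bar> powr p) \<le> c powr p"
    by (meson not_le powr_ge_zero powr_less_mono2)
  then show ?thesis
    using Lp_norm_le_iff[OF p, of c] c unfolding p_def c_def by simp
qed

end

end

end

section \<open>Enumerations\<close>

text \<open>The elements are ranked by decreasing weight. Those up to \<open>t\<close> all weigh at
  least \<open>w t\<close>, so their number times \<open>w t\<close> is at most \<open>c\<close>; as
  \<open>w t\<close> is positive, this also makes every rank finite.\<close>

lemma enumeration_by_weight:
  fixes w :: "'b \<Rightarrow> real"
  assumes S: "countable S" and pos: "\<And>s. s \<in> S \<Longrightarrow> 0 < w s"
    and sums: "\<And>F. finite F \<Longrightarrow> F \<subseteq> S \<Longrightarrow> sum w F \<le> c"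
  obtains t where "bij_betw t (enum_index S) S" "\<And>i. i \<in> enum_index S \<Longrightarrow> real i * w (t i) \<le> c"
proof -
  define j where "j = to_nat_on S"
  have j: "inj_on j S"
    unfolding j_def using S by (rule inj_on_to_nat_on)
  \<comment> \<open>Ties are broken by the index \<open>j\<close>, which makes the order total and
    the rank injective.\<close>
  define before where "before s t \<longleftrightarrow> w t < w s \<or> (w s = w t \<and> j s \<le> j t)" for s t
  define D where "D t = {s \<in> S. before s t}" for t
  define rank where "rank t = card (D t)" for t
  have card_bound: "real (card F) * w t \<le> c" if "finite F" "F \<subseteq> D t" for F t
  proof -
    have "real (card F) * w t = (\<Sum>s\<in>F. w t)"
      by simp
    also have "\<dots> \<le> sum w F"
      using that by (intro sum_mono) (auto simp: D_def before_def)
    also have "\<dots> \<le> c"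
      using that by (intro sums) (auto simp: D_def)
    finally show ?thesis .
  qed
  have finite_D: "finite (D t)" if "t \<in> S" for t
  proof -
    have "card F \<le> nat \<lfloor>c / w t\<rfloor>" if "F \<subseteq> D t" "finite F" for F
      using card_bound[OF that(2,1)] pos[OF \<open>t \<in> S\<close>] by (simp add: le_nat_floor pos_le_divide_eq)
    then show ?thesis
      using finite_if_finite_subsets_card_bdd by blast
  qed
  have refl: "t \<in> D t" if "t \<in> S" for t
    using that by (auto simp: D_def before_def)
  have D_mono: "D s \<subseteq> D t" if "s \<in> D t" for s t
    using that by (auto simp: D_def before_def)
  have inj: "inj_on rank S"
  proof (rule inj_onI)
    fix s t assume st: "s \<in> S" "t \<in> S" "rank s = rank t"
    have "s \<in> D t \<or> t \<in> D s"
      using st by (auto simp: D_def before_def)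
    then have "D s = D t"
      using st card_subset_eq[OF finite_D D_mono] unfolding rank_def by metis
    then have "before s t" "before t s"
      using refl st by (auto simp: D_def)
    then have "j s = j t"
      by (auto simp: before_def)
    then show "s = t"
      using j st by (auto dest: inj_onD)
  qed
  \<comment> \<open>The ranks have no gaps: an injection of \<open>D t\<close> into a set of the
    same finite size is onto.\<close>
  have rank_D: "rank ` D t = {1..rank t}" if t: "t \<in> S" for t
  proof (rule card_subset_eq)
    have "1 \<le> rank s" "rank s \<le> rank t" if "s \<in> D t" for s
      using that finite_D[OF t] finite_D[of s] D_mono[OF that] refl[of s] unfolding rank_def
      by (auto intro: card_mono simp: Suc_le_eq card_gt_0_iff D_def)
    then show "rank ` D t \<subseteq> {1..rank t}"
      by auto
    have "inj_on rank (D t)"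
      using inj by (rule inj_on_subset) (auto simp: D_def)
    then show "card (rank ` D t) = card {1..rank t}"
      by (simp add: card_image) (simp add: rank_def)
  qed simp
  have "rank ` S = enum_index S"
  proof (intro equalityI subsetI)
    fix i assume "i \<in> rank ` S"
    then obtain t where t: "t \<in> S" "i = rank t"
      by auto
    have "1 \<le> rank t"
      using finite_D[OF t(1)] refl[OF t(1)] unfolding rank_def by (auto simp: Suc_le_eq card_gt_0_iff)
    moreover have "rank t \<le> card S" if "finite S"
      unfolding rank_def using that by (intro card_mono) (auto simp: D_def)
    ultimately show "i \<in> enum_index S"
      using t by (simp add: enum_index_def)
  next
    fix i assume i: "i \<in> enum_index S"
    \<comment> \<open>If all ranks were below \<open>i\<close>, injectivity would make
      \<open>S\<close> finite with fewer than \<open>i\<close> elements.\<close>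
    have "\<exists>t\<in>S. i \<le> rank t"
    proof (rule ccontr)
      assume "\<not> ?thesis"
      moreover have "1 \<le> rank t" if "t \<in> S" for t
        using finite_D[OF that] refl[OF that] unfolding rank_def by (auto simp: Suc_le_eq card_gt_0_iff)
      ultimately have sub: "rank ` S \<subseteq> {1..<i}"
        by force
      then have "finite S"
        using inj finite_imageD finite_subset by blast
      moreover have "card S < i"
        using card_mono[OF _ sub] card_image[OF inj] i by (auto simp: enum_index_def)
      ultimately show False
        using i by (simp add: enum_index_def)
    qed
    then obtain t where "t \<in> S" "i \<in> {1..rank t}"
      using i by (auto simp: enum_index_def)
    then show "i \<in> rank ` S"
      using rank_D[of t] by (auto simp: D_def)
  qed
  then have bij: "bij_betw rank S (enum_index S)"
    using inj by (simp add: bij_betw_def)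
  show thesis
  proof (rule that)
    show "bij_betw (inv_into S rank) (enum_index S) S"
      using bij by (rule bij_betw_inv_into)
    fix i assume "i \<in> enum_index S"
    then have "inv_into S rank i \<in> S" "rank (inv_into S rank i) = i"
      using bij by (auto simp: bij_betw_def f_inv_into_f inv_into_into)
    then show "real i * w (inv_into S rank i) \<le> c"
      using card_bound[OF finite_D order_refl, of "inv_into S rank i"] by (simp add: rank_def)
  qed
qed

text \<open>A decreasing enumeration need not exist, since infinitely many terms may vanish; adding
  geometric weights makes all terms positive at the cost of a factor 2.\<close>

lemma enumeration_of_summable:
  fixes a :: "'b \<Rightarrow> real"
  assumes S: "countable S" and nonneg: "\<And>s. s \<in> S \<Longrightarrow> 0 \<le> a s" and A: "0 < A"
    and sums: "\<And>F. finite F \<Longrightarrow> F \<subseteq> S \<Longrightarrow> sum a F \<le> A"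
  obtains t where "bij_betw t (enum_index S) S" "\<And>i. i \<in> enum_index S \<Longrightarrow> real i * a (t i) \<le> 2 * A"
proof -
  define g where "g s = (1 / 2 :: real) ^ Suc (to_nat_on S s)" for s
  \<comment> \<open>Each of the two summands has total mass at most 1.\<close>
  define w where "w s = a s / A + g s" for s
  have "sum w F \<le> 2" if F: "finite F" "F \<subseteq> S" for F
  proof -
    have "inj_on (to_nat_on S) F"
      using inj_on_to_nat_on[OF S] F(2) by (rule inj_on_subset)
    then have "sum g F = (\<Sum>n\<in>to_nat_on S ` F. (1 / 2) ^ Suc n)"
      unfolding g_def by (simp add: sum.reindex)
    also have "\<dots> \<le> (\<Sum>n. (1 / 2) ^ Suc n)"
      using F by (intro sum_le_suminf sums_summable[OF power_half_series]) auto
    also have "\<dots> = 1"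
      using power_half_series by (rule sums_unique[symmetric])
    finally have "sum g F \<le> 1" .
    moreover have "sum a F / A \<le> 1"
      using sums[OF F] A by simp
    ultimately show ?thesis
      by (simp add: w_def sum.distrib flip: sum_divide_distrib)
  qed
  moreover have "0 < w s" if "s \<in> S" for s
    unfolding w_def g_def using nonneg[OF that] A by (intro add_nonneg_pos) auto
  ultimately obtain t where t: "bij_betw t (enum_index S) S"
    "\<And>i. i \<in> enum_index S \<Longrightarrow> real i * w (t i) \<le> 2"
    using enumeration_by_weight[OF S, of w 2] by metis
  have "real i * a (t i) \<le> 2 * A" if "i \<in> enum_index S" for i
  proof -
    have "real i * (a (t i) / A) \<le> real i * w (t i)"
      by (intro mult_left_mono) (auto simp: w_def g_def)
    also have "\<dots> \<le> 2"
      by (rule t(2)[OF that])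
    finally show ?thesis
      using A by (simp add: field_simps)
  qed
  with t(1) that show thesis
    by blast
qed

lemma sum_inverse_square_le:
  assumes "finite F" "0 \<notin> F"
  shows "(\<Sum>i\<in>F. 1 / (real i * (real i + 1))) \<le> 1"
proof -
  obtain n where n: "F \<subseteq> {..n}"
    using assms(1) finite_nat_iff_bounded_le by auto
  have "(\<Sum>i\<in>F. 1 / (real i * (real i + 1))) \<le> (\<Sum>i=1..n. 1 / (real i * (real i + 1)))"
    using n assms by (intro sum_mono2) (auto simp: Suc_le_eq intro!: gr0I)
  also have "\<dots> = (\<Sum>i=1..n. 1 / real i - 1 / (real i + 1))"
    by (intro sum.cong) (auto simp: field_simps)
  also have "\<dots> = 1 - 1 / (real n + 1)"
    by (induction n) (auto simp: add.commute)
  finally show ?thesis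
    by (smt (verit) divide_nonneg_nonneg of_nat_0_le_iff)
qed

section \<open>From the norm hypotheses to moment doubling of linear forms\<close>

lemma (in prob_space) integrable_power_of_Lp_norm:
  assumes [measurable]: "Z \<in> borel_measurable M" and "\<And>p. 1 \<le> p \<Longrightarrow> Lp_norm M p Z < \<infinity>"
  shows "integrable M (\<lambda>x. Z x ^ k)"
proof (cases "k = 0")
  case False
  then have "Lp_norm M (real k) Z < \<infinity>"
    using assms(2)[of "real k"] by simp
  then have "(\<integral>\<^sup>+x. ennreal (\<bar>Z x\<bar> powr real k) \<partial>M) < \<infinity>"
    unfolding Lp_norm_def Let_def by (auto simp: less_top split: if_splits)
  then show ?thesis
    using False by (intro integrableI_bounded) (auto simp: powr_of_nat power_abs)
qed simp

lemma (in prob_space) power_moment_doubling_of_Lp_norm: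
  assumes [measurable]: "Z \<in> borel_measurable M"
    and fin: "\<And>p. 1 \<le> p \<Longrightarrow> Lp_norm M p Z < \<infinity>"
    and double: "\<And>p. 1 \<le> p \<Longrightarrow> Lp_norm M (2 * p) Z \<le> ennreal \<alpha> * Lp_norm M p Z"
    and \<alpha>: "0 \<le> \<alpha>" and k: "1 \<le> k"
  shows "expectation (\<lambda>x. Z x ^ (2 * k)) \<le> \<alpha> ^ (2 * k) * (expectation (\<lambda>x. \<bar>Z x\<bar> ^ k))\<^sup>2"
proof -
  note int = integrable_power_of_Lp_norm[OF assms(1) fin]
  let ?a = "expectation (\<lambda>x. Z x ^ (2 * k))" and ?b = "expectation (\<lambda>x. \<bar>Z x\<bar> ^ k)"
  have "\<bar>z\<bar> powr (2 * real k) = z ^ (2 * k)" "\<bar>z\<bar> powr real k = \<bar>z\<bar> ^ k" for z :: real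
    using k powr_of_nat[of "\<bar>z\<bar>" "2 * k"] powr_of_nat[of "\<bar>z\<bar>" k] by (auto simp: power_even_abs)
  then have "ennreal (?a powr (1 / (2 * real k))) \<le> ennreal \<alpha> * ennreal (?b powr (1 / real k))"
    using double[of "real k"] Lp_norm_eq[OF assms(1) int, of "real k"]
      Lp_norm_eq[OF assms(1) int, of "2 * real k"] k by simp
  then have "?a powr (1 / (2 * real k)) \<le> \<alpha> * ?b powr (1 / real k)"
    using \<alpha> by (simp flip: ennreal_mult)
  then have "(?a powr (1 / (2 * real k))) ^ (2 * k) \<le> (\<alpha> * ?b powr (1 / real k)) ^ (2 * k)"
    by (rule power_mono) simp
  moreover have "(?a powr (1 / (2 * real k))) ^ (2 * k) = ?a"
    using k powr_of_nat[of "?a powr (1 / (2 * real k))" "2 * k"]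
    by (simp add: powr_powr integral_nonneg_AE zero_le_even_power)
  moreover have "(?b powr (1 / real k)) ^ (2 * k) = ?b\<^sup>2"
    using k powr_of_nat[of "?b powr (1 / real k)" k]
    by (simp add: powr_powr integral_nonneg_AE power_mult mult.commute[of 2])
  ultimately show ?thesis
    by (simp add: power_mult_distrib)
qed

text \<open>Replacing \<alpha> by \<open>max \<alpha> 1\<close> keeps the hypothesis and makes the
  constant at least 1. The value of \<beta> is what \<open>double_moment_first\<close> gives for the
  exponents 1 and 2; it also dominates the constant \<open>48 * max \<alpha> 1\<close> valid for
  larger dyadic exponents.\<close>

lemma admissible_lin_form:
  fixes X :: "nat \<Rightarrow> 'a \<Rightarrow> real"
  assumes adm: "admissible M \<alpha> n X"
  defines "\<beta> \<equiv> 4 * (48 * max \<alpha> 1)\<^sup>2"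
  shows "lin_form n X t \<in> borel_measurable M"
    and "integrable M (\<lambda>x. lin_form n X t x ^ k)"
    and "(\<integral>x. \<bar>lin_form n X t x\<bar> ^ 2 ^ Suc j \<partial>M) \<le> \<beta> ^ 2 ^ Suc j * (\<integral>x. \<bar>lin_form n X t x\<bar> ^ 2 ^ j \<partial>M)\<^sup>2"
proof -
  interpret prob_space M
    using adm by (simp add: admissible_def)
  define \<alpha>' where "\<alpha>' = max \<alpha> 1"
  have \<alpha>': "1 \<le> \<alpha>'"
    by (simp add: \<alpha>'_def)
  have meas: "X i \<in> borel_measurable M" and mean: "expectation (X i) = 0"
    and fin: "\<And>p. 1 \<le> p \<Longrightarrow> Lp_norm M p (X i) < \<infinity>"
    and double: "\<And>p. 1 \<le> p \<Longrightarrow> Lp_norm M (2 * p) (X i) \<le> ennreal \<alpha>' * Lp_norm M p (X i)"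
    if "i \<in> {1..n}" for i
  proof -
    show "X i \<in> borel_measurable M" "expectation (X i) = 0"
      using adm that by (auto simp: admissible_def has_bochner_integral_iff)
    fix p :: real assume "1 \<le> p"
    then have *: "Lp_norm M p (X i) < \<infinity>" "Lp_norm M (2 * p) (X i) \<le> ennreal \<alpha> * Lp_norm M p (X i)"
      using adm that by (auto simp: admissible_def)
    then show "Lp_norm M p (X i) < \<infinity>"
      by simp
    have "ennreal \<alpha> * Lp_norm M p (X i) \<le> ennreal \<alpha>' * Lp_norm M p (X i)"
      by (intro mult_right_mono ennreal_leI) (auto simp: \<alpha>'_def)
    with *(2) show "Lp_norm M (2 * p) (X i) \<le> ennreal \<alpha>' * Lp_norm M p (X i)"
      by (rule order_trans)
  qed
  have int: "integrable M (\<lambda>x. (t i * X i x) ^ k)" if "i \<in> {1..n}" for i k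
    using integrable_power_of_Lp_norm[OF meas fin, OF that that] by (simp add: power_mult_distrib)
  have lin: "lin_form n X t = (\<lambda>x. \<Sum>i\<in>{1..n}. t i * X i x)"
    by (auto simp: lin_form_def)
  show [measurable]: "lin_form n X t \<in> borel_measurable M"
    unfolding lin using meas by (intro borel_measurable_sum borel_measurable_times) auto
  show int_lin: "integrable M (\<lambda>x. lin_form n X t x ^ k)" for k
    unfolding lin using meas int by (intro integrable_power_sum) auto
  have indep: "indep_vars (\<lambda>_. borel) (\<lambda>i x. t i * X i x) {1..n}"
    using adm by (intro indep_vars_compose2[where Y = "\<lambda>i x. t i * x"]) (auto simp: admissible_def)
  have sum_double: "expectation (\<lambda>x. lin_form n X t x ^ (2 * p))
      \<le> (48 * \<alpha>') ^ (2 * p) * (expectation (\<lambda>x. lin_form n X t x ^ p))\<^sup>2" if "even p" "0 < p" for p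
    unfolding lin
  proof (rule sum_moment_doubling[OF _ indep])
    fix i k assume i: "i \<in> {1..n}" and k: "1 \<le> (k :: nat)"
    have "(t i)\<^sup>2 ^ k * expectation (\<lambda>x. X i x ^ (2 * k))
        \<le> (t i)\<^sup>2 ^ k * (\<alpha>' ^ (2 * k) * (expectation (\<lambda>x. \<bar>X i x\<bar> ^ k))\<^sup>2)"
      using \<alpha>' power_moment_doubling_of_Lp_norm[OF meas[OF i] fin[OF i] double[OF i] _ k]
      by (intro mult_left_mono) auto
    then show "expectation (\<lambda>x. (t i * X i x) ^ (2 * k)) \<le> \<alpha>' ^ (2 * k) * (expectation (\<lambda>x. \<bar>t i * X i x\<bar> ^ k))\<^sup>2"
      by (simp add: power_mult_distrib abs_mult power_mult mult_ac power_even_eq flip: power_abs)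
        (simp add: power_mult_distrib mult_ac flip: power_mult)
  qed (use \<alpha>' int mean that in auto)
  show "(\<integral>x. \<bar>lin_form n X t x\<bar> ^ 2 ^ Suc j \<partial>M) \<le> \<beta> ^ 2 ^ Suc j * (\<integral>x. \<bar>lin_form n X t x\<bar> ^ 2 ^ j \<partial>M)\<^sup>2"
  proof (cases j)
    case 0
    have "expectation (\<lambda>x. lin_form n X t x ^ 2) \<le> (4 * (48 * \<alpha>')\<^sup>2)\<^sup>2 * (expectation (\<lambda>x. \<bar>lin_form n X t x\<bar>))\<^sup>2"
      using sum_double[of 2] \<alpha>' int_lin by (intro double_moment_first) auto
    then show ?thesis
      by (simp add: 0 \<beta>_def \<alpha>'_def)
  next
    case (Suc l)
    let ?p = "2 ^ j :: nat"
    have p: "even ?p" "0 < ?p"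
      by (auto simp: Suc)
    have abs_even: "\<bar>a\<bar> ^ ?p = a ^ ?p" "\<bar>a\<bar> ^ (2 * ?p) = a ^ (2 * ?p)" for a :: real
      using p by (auto simp: power_even_abs)
    have "48 * \<alpha>' \<le> (48 * \<alpha>')\<^sup>2"
      using \<alpha>' by (intro self_le_power) auto
    then have "48 * \<alpha>' \<le> \<beta>"
      unfolding \<beta>_def \<alpha>'_def[symmetric] by (smt (verit) zero_le_power2)
    then have "(48 * \<alpha>') ^ (2 * ?p) \<le> \<beta> ^ (2 * ?p)"
      using \<alpha>' by (intro power_mono) auto
    then have "(48 * \<alpha>') ^ (2 * ?p) * (expectation (\<lambda>x. lin_form n X t x ^ ?p))\<^sup>2
        \<le> \<beta> ^ (2 * ?p) * (expectation (\<lambda>x. lin_form n X t x ^ ?p))\<^sup>2"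
      by (intro mult_right_mono) auto
    with sum_double[OF p] show ?thesis
      by (simp add: abs_even del: power_abs)
  qed
qed

section \<open>Comparison of the two functionals\<close>

lemma infsum_ennreal_le:
  fixes f :: "'b \<Rightarrow> ennreal"
  assumes "\<And>F. finite F \<Longrightarrow> F \<subseteq> S \<Longrightarrow> sum f F \<le> c"
  shows "infsum f S \<le> c"
  using assms by (intro infsum_le_finite_sums nonneg_summable_on_complete) auto

lemma sum_le_infsum_ennreal:
  fixes f :: "'b \<Rightarrow> ennreal"
  assumes "finite F" "F \<subseteq> S"
  shows "sum f F \<le> infsum f S"
  using assms by (subst nonneg_infsum_complete) (auto intro: SUP_upper)

lemma one_le_doubling_constant: "1 \<le> 4 * (48 * max \<alpha> 1)\<^sup>2" for \<alpha> :: real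
proof -
  have "1 \<le> (48 * max \<alpha> 1)\<^sup>2"
    by (intro one_le_power) linarith
  then show ?thesis
    by linarith
qed

text \<open>For \<open>v\<close> above \<open>small_m\<close>, some enumeration has all its norms
  below \<open>v\<close>. At the level \<open>u\<close> of \<open>truncated_moment_le\<close> the
  truncated moments sum to at most \<open>u\<close>, so \<open>big_M\<close> is at most
  \<open>2 * u = C * v\<close>; finally \<open>v\<close> decreases to
  \<open>small_m\<close>.\<close>

lemma big_M_le_small_m:
  fixes X :: "nat \<Rightarrow> 'a \<Rightarrow> real"
  assumes adm: "admissible M \<alpha> n X"
  defines "\<beta> \<equiv> 4 * (48 * max \<alpha> 1)\<^sup>2"
  shows "big_M M n X S \<le> ennreal (2 * exp 1 * \<beta>\<^sup>2) * small_m M n X S"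
proof -
  interpret prob_space M
    using adm by (simp add: admissible_def)
  have \<beta>: "1 \<le> \<beta>"
    unfolding \<beta>_def by (rule one_le_doubling_constant)
  note lin = admissible_lin_form[OF adm, folded \<beta>_def]
  define C where "C = 2 * exp 1 * \<beta>\<^sup>2"
  have C: "0 < C"
    using \<beta> by (simp add: C_def)
  have main: "big_M M n X S \<le> ennreal (C * v)" if v: "0 < v" "small_m M n X S < ennreal v" for v
  proof -
    obtain t where t: "bij_betw t (enum_index S) S"
      and sup: "(SUP i\<in>enum_index S. Lp_norm M (ln (exp 1 + real i)) (lin_form n X (t i))) < ennreal v"
      using v(2) unfolding small_m_def INF_less_iff by auto
    have norm: "Lp_norm M (ln (exp 1 + real i)) (lin_form n X (t i)) \<le> ennreal v" if "i \<in> enum_index S" for i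
      using SUP_upper[OF that, of "\<lambda>i. Lp_norm M (ln (exp 1 + real i)) (lin_form n X (t i))"] sup
      by (meson less_imp_le order_trans)
    define u where "u = exp 1 * \<beta>\<^sup>2 * v"
    have u: "0 < u"
      using \<beta> v by (simp add: u_def)
    let ?T = "\<lambda>s. \<integral>\<^sup>+\<omega>. ennreal \<bar>lin_form n X s \<omega>\<bar> * indicator {\<omega>. \<bar>lin_form n X s \<omega>\<bar> \<ge> u} \<omega> \<partial>M"
    have term_le: "?T (t i) \<le> ennreal (u * (1 / (real i * (real i + 1))))" if i: "i \<in> enum_index S" for i
    proof -
      let ?p = "ln (exp 1 + real i)"
      have pos: "0 < exp 1 + real i" "1 \<le> real i"
        using i by (auto simp: enum_index_def intro: add_pos_nonneg)
      have "ln (exp 1) \<le> ?p"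
        using pos by (subst ln_le_cancel_iff) auto
      then have "?T (t i) \<le> ennreal (u * exp (- (2 * ?p)))"
        using v norm[OF i] by (intro truncated_moment_le[OF lin(1,2) \<beta> lin(3)]) (auto simp: u_def)
      \<comment> \<open>The logarithmic exponent turns exponential decay in \<open>?p\<close> into
        the summable inverse square.\<close>
      also have "exp (- (2 * ?p)) = 1 / (exp 1 + real i)\<^sup>2"
        using pos by (simp add: exp_minus exp_double divide_inverse)
      also have "ennreal (u * (1 / (exp 1 + real i)\<^sup>2)) \<le> ennreal (u * (1 / (real i * (real i + 1))))"
      proof (intro ennreal_leI mult_left_mono divide_left_mono)
        have "real i * (real i + 1) \<le> (exp 1 + real i) * (exp 1 + real i)"
          using exp_ge_add_one_self[of 1] pos by (intro mult_mono) auto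
        then show "real i * (real i + 1) \<le> (exp 1 + real i)\<^sup>2"
          by (simp add: power2_eq_square)
      qed (use u pos in auto)
      finally show ?thesis .
    qed
    have "infsum ?T S = infsum (\<lambda>i. ?T (t i)) (enum_index S)"
      using t by (rule infsum_reindex_bij_betw[symmetric])
    also have "\<dots> \<le> ennreal u"
    proof (rule infsum_ennreal_le)
      fix F assume F: "finite F" "F \<subseteq> enum_index S"
      have "(\<Sum>i\<in>F. ?T (t i)) \<le> (\<Sum>i\<in>F. ennreal (u * (1 / (real i * (real i + 1)))))"
        using F term_le by (intro sum_mono) auto
      also have "\<dots> = ennreal (u * (\<Sum>i\<in>F. 1 / (real i * (real i + 1))))"
        using u by (subst sum_ennreal) (auto simp: sum_distrib_left)
      also have "\<dots> \<le> ennreal (u * 1)"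
        using u F by (intro ennreal_leI mult_left_mono sum_inverse_square_le) (auto simp: enum_index_def)
      finally show "(\<Sum>i\<in>F. ?T (t i)) \<le> ennreal u"
        by simp
    qed
    finally have "ennreal u + infsum ?T S \<le> ennreal u + ennreal u"
      by (rule add_left_mono)
    also have "\<dots> = ennreal (C * v)"
      using u by (simp add: C_def u_def mult_ac flip: ennreal_plus)
    finally have "ennreal u + infsum ?T S \<le> ennreal (C * v)" .
    moreover have "big_M M n X S \<le> ennreal u + infsum ?T S"
      unfolding big_M_def using u by (intro INF_lower) auto
    ultimately show ?thesis
      by (rule order_trans[rotated])
  qed
  show ?thesis
    unfolding C_def[symmetric]
  proof (cases "small_m M n X S")
    case top
    then show "big_M M n X S \<le> ennreal C * small_m M n X S"
      using C by (simp add: ennreal_mult_top)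
  next
    case (real r)
    show "big_M M n X S \<le> ennreal C * small_m M n X S"
    proof (rule ennreal_le_epsilon)
      fix e :: real assume e: "0 < e"
      have "big_M M n X S \<le> ennreal (C * (r + e / C))"
        using real e C by (intro main) (auto simp: add_nonneg_pos ennreal_less_iff)
      also have "\<dots> = ennreal C * small_m M n X S + ennreal e"
        using real e C by (simp add: distrib_left flip: ennreal_mult ennreal_plus)
      finally show "big_M M n X S \<le> ennreal C * small_m M n X S + ennreal e" .
    qed
  qed
qed

text \<open>For each level \<open>u\<close>, with \<open>A\<close> the value of the functional
  there, the first moment of every form is at most \<open>A\<close>. A suitable enumeration makes
  the truncated moments at most \<open>2 * A / i\<close>, and Markov's inequality gives the tail
  bound needed by \<open>Lp_norm_log_le\<close>.\<close>

lemma small_m_le_big_M: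
  fixes X :: "nat \<Rightarrow> 'a \<Rightarrow> real" and S :: "(nat \<Rightarrow> real) set"
  assumes adm: "admissible M \<alpha> n X" and S: "countable S" "S \<noteq> {}"
  defines "\<beta> \<equiv> 4 * (48 * max \<alpha> 1)\<^sup>2"
  assumes K: "3 \<le> K" "8 * ln \<beta> \<le> 2 ^ K"
  shows "ennreal (1 / (2 * \<beta> ^ K)) * small_m M n X S \<le> big_M M n X S"
  unfolding big_M_def
proof (rule INF_greatest)
  fix u :: real assume "u \<in> {0<..}"
  then have u: "0 < u"
    by simp
  interpret prob_space M
    using adm by (simp add: admissible_def)
  have \<beta>: "1 \<le> \<beta>"
    unfolding \<beta>_def by (rule one_le_doubling_constant)
  note lin = admissible_lin_form[OF adm, folded \<beta>_def]
  note [measurable] = lin(1)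
  let ?T = "\<lambda>s. \<integral>\<^sup>+\<omega>. ennreal \<bar>lin_form n X s \<omega>\<bar> * indicator {\<omega>. \<bar>lin_form n X s \<omega>\<bar> \<ge> u} \<omega> \<partial>M"
  show "ennreal (1 / (2 * \<beta> ^ K)) * small_m M n X S \<le> ennreal u + infsum ?T S"
  proof (cases "infsum ?T S")
    case (real r)
    define A where "A = u + r"
    have A: "0 < A" "u \<le> A"
      using u real by (auto simp: A_def)
    define a where "a s = enn2real (?T s)" for s
    have Ta: "?T s = ennreal (a s)" "0 \<le> a s" if "s \<in> S" for s
    proof -
      have "?T s \<le> infsum ?T S"
        using sum_le_infsum_ennreal[of "{s}" S ?T] that by simp
      then show "?T s = ennreal (a s)"
        using real unfolding a_def by (simp add: le_less_trans[of _ "ennreal r"] less_top)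
    qed (simp add: a_def)
    have sums: "sum a F \<le> r" if "finite F" "F \<subseteq> S" for F
    proof -
      have "ennreal (sum a F) = sum ?T F"
        using that Ta by (subst sum_ennreal[symmetric]) (auto intro!: sum.cong)
      also have "\<dots> \<le> ennreal r"
        using sum_le_infsum_ennreal[OF that, of ?T] real by simp
      finally show ?thesis
        using real by simp
    qed
    have sums_A: "sum a F \<le> A" if "finite F" "F \<subseteq> S" for F
      using sums[OF that] u by (simp add: A_def)
    obtain t where t: "bij_betw t (enum_index S) S"
      "\<And>i. i \<in> enum_index S \<Longrightarrow> real i * a (t i) \<le> 2 * A"
    proof (rule enumeration_of_summable[OF S(1) Ta(2) A(1) sums_A])
      fix t
      assume "bij_betw t (enum_index S) S" "\<And>i. i \<in> enum_index S \<Longrightarrow> real i * a (t i) \<le> 2 * A"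
      then show thesis
        by (rule that)
    qed
    have norm: "Lp_norm M (ln (exp 1 + real i)) (lin_form n X (t i)) \<le> ennreal (2 * \<beta> ^ K * A)"
      if i: "i \<in> enum_index S" for i
    proof -
      let ?Z = "lin_form n X (t i)"
      have s: "t i \<in> S"
        using t(1) i by (auto simp: bij_betw_def)
      have i1: "1 \<le> i"
        using i by (simp add: enum_index_def)
      have intZ: "integrable M (\<lambda>x. \<bar>?Z x\<bar>)"
        using lin(2)[of "t i" 1] by simp
      have "ennreal (expectation (\<lambda>x. \<bar>?Z x\<bar>)) = (\<integral>\<^sup>+x. ennreal \<bar>?Z x\<bar> \<partial>M)"
        using intZ by (simp add: nn_integral_eq_integral)
      also have "\<dots> \<le> (\<integral>\<^sup>+x. ennreal u + ennreal \<bar>?Z x\<bar> * indicator {\<omega>. \<bar>?Z \<omega>\<bar> \<ge> u} x \<partial>M)"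
        by (intro nn_integral_mono) (auto simp: indicator_def intro: ennreal_leI)
      also have "\<dots> = ennreal u + ?T (t i)"
        by (subst nn_integral_add) (auto simp: indicator_def emeasure_space_1)
      also have "\<dots> = ennreal (u + a (t i))"
        using Ta[OF s] u by simp
      finally have "expectation (\<lambda>x. \<bar>?Z x\<bar>) \<le> u + a (t i)"
        using u Ta(2)[OF s] by (simp del: ennreal_plus)
      then have mean_le: "expectation (\<lambda>x. \<bar>?Z x\<bar>) \<le> A"
        using sums[of "{t i}"] s by (simp add: A_def)
      let ?B = "{x \<in> space M. A \<le> \<bar>?Z x\<bar>}"
      have "ennreal (A * prob ?B) = (\<integral>\<^sup>+x. ennreal A * indicator ?B x \<partial>M)"
        using A by (simp add: nn_integral_cmult_indicator emeasure_eq_measure ennreal_mult)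
      \<comment> \<open>As \<open>u \<le> A\<close>, the event \<open>?B\<close> lies inside the
        truncation event, and there the form is at least \<open>A\<close> in absolute value.\<close>
      also have "\<dots> \<le> ?T (t i)"
        using A by (intro nn_integral_mono) (auto simp: indicator_def intro: ennreal_leI)
      finally have "A * prob ?B \<le> a (t i)"
        using Ta[OF s] by simp
      then have "A * (real i * prob ?B) \<le> A * 2"
        using t(2)[OF i] mult_left_mono[of "A * prob ?B" "a (t i)" "real i"] by (simp add: mult_ac)
      then have "real i * prob ?B \<le> 2"
        using A by simp
      then have "prob ?B \<le> 2 / real i"
        using i1 by (simp add: field_simps)
      then show ?thesis
        by (intro Lp_norm_log_le[OF lin(1,2) \<beta> lin(3)] A i1 mean_le K)
    qed
    have "small_m M n X S \<le> (SUP i\<in>enum_index S. Lp_norm M (ln (exp 1 + real i)) (lin_form n X (t i)))"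
      unfolding small_m_def using t(1) by (intro INF_lower) simp
    also have "\<dots> \<le> ennreal (2 * \<beta> ^ K * A)"
      by (intro SUP_least norm)
    finally have "ennreal (1 / (2 * \<beta> ^ K)) * small_m M n X S \<le> ennreal (1 / (2 * \<beta> ^ K)) * ennreal (2 * \<beta> ^ K * A)"
      by (rule mult_left_mono) simp
    also have "\<dots> = ennreal A"
      using \<beta> A by (simp flip: ennreal_mult)
    also have "\<dots> = ennreal u + infsum ?T S"
      using u real by (simp add: A_def)
    finally show ?thesis .
  qed simp
qed

text \<open>\<beta> and \<open>K\<close> depend on \<alpha> alone, hence so do the constants; they
  are ordered because \<open>c \<le> 1 \<le> C\<close>.\<close>

lemma comparison_exists: "\<exists>c C. 0 < c \<and> c \<le> C \<and> comparison TYPE('a) \<alpha> c C"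
proof -
  define \<beta> where "\<beta> = 4 * (48 * max \<alpha> 1)\<^sup>2"
  have \<beta>: "1 \<le> \<beta>"
    unfolding \<beta>_def by (rule one_le_doubling_constant)
  obtain m where m: "8 * ln \<beta> < 2 ^ m"
    using real_arch_pow[of 2 "8 * ln \<beta>"] by auto
  define K where "K = max 3 m"
  have "(2 :: real) ^ m \<le> 2 ^ K"
    by (intro power_increasing) (auto simp: K_def)
  with m have K: "3 \<le> K" "8 * ln \<beta> \<le> 2 ^ K"
    by (simp add: K_def, linarith)
  define c where "c = 1 / (2 * \<beta> ^ K)"
  define C where "C = 2 * exp 1 * \<beta>\<^sup>2"
  have "1 \<le> \<beta> ^ K" "1 \<le> \<beta>\<^sup>2"
    using \<beta> by (auto intro: one_le_power)
  then have "0 < c" "c \<le> 1"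
    unfolding c_def by (auto simp: field_simps)
  moreover have "1 * 1 \<le> (2 * exp 1) * \<beta>\<^sup>2"
    using \<open>1 \<le> \<beta>\<^sup>2\<close> exp_ge_add_one_self[of 1] by (intro mult_mono) auto
  then have "1 \<le> C"
    by (simp add: C_def)
  moreover have "comparison TYPE('a) \<alpha> c C"
    unfolding comparison_def
  proof (intro allI impI, elim conjE)
    fix n :: nat and M :: "'a measure" and X and S :: "(nat \<Rightarrow> real) set"
    assume adm: "admissible M \<alpha> n X" and S: "S \<noteq> {}" "countable S"
    show "ennreal c * small_m M n X S \<le> big_M M n X S \<and> big_M M n X S \<le> ennreal C * small_m M n X S"
      using small_m_le_big_M[OF adm S(2,1) K[unfolded \<beta>_def]] big_M_le_small_m[OF adm, of S]
      unfolding c_def C_def \<beta>_def by blast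
  qed
  ultimately show ?thesis
    by (intro exI[of _ c] exI[of _ C]) auto
qed

text \<open>All quantities depend only on the joint law of \<open>X\<close>, which lives on \<open>nat \<Rightarrow> real\<close>.\<close>

lemma comparison_transfer:
  assumes "comparison TYPE(nat \<Rightarrow> real) \<alpha> c C"
  shows "comparison TYPE('a) \<alpha> c C"
  unfolding comparison_def
proof (intro allI impI)
  fix n :: nat and M :: "'a measure" and X :: "nat \<Rightarrow> 'a \<Rightarrow> real" and S
  assume n: "1 \<le> n" and adm: "admissible M \<alpha> n X" and S: "S \<subseteq> vectors n" "S \<noteq> {} \<and> countable S"
  interpret prob_space M
    using adm by (simp add: admissible_def)
  let ?I = "{1..n}"
  define P :: "(nat \<Rightarrow> real) measure" where "P = (\<Pi>\<^sub>M i\<in>?I. borel)"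
  define \<phi> where "\<phi> = (\<lambda>\<omega>. \<lambda>i\<in>?I. X i \<omega>)"
  \<comment> \<open>\<open>N\<close> is the joint law on extensional functions, under which the
    coordinates \<open>Y\<close> play the part of \<open>X\<close>.\<close>
  define N where "N = distr M P \<phi>"
  define Y :: "nat \<Rightarrow> (nat \<Rightarrow> real) \<Rightarrow> real" where "Y = (\<lambda>i x. x i)"
  have I: "?I \<noteq> {}"
    using n by simp
  have X [measurable]: "X i \<in> borel_measurable M" if "i \<in> ?I" for i
    using adm that by (auto simp: admissible_def has_bochner_integral_iff)
  have \<phi> [measurable]: "\<phi> \<in> measurable M P"
    unfolding \<phi>_def P_def by (rule measurable_restrict) (rule X)
  have Y [measurable]: "Y i \<in> borel_measurable P" if "i \<in> ?I" for i
    unfolding Y_def P_def using that by (rule measurable_component_singleton)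
  have Y\<phi>: "Y i (\<phi> \<omega>) = X i \<omega>" if "i \<in> ?I" for i \<omega>
    using that by (simp add: Y_def \<phi>_def)
  have lin_meas [measurable]: "lin_form n Y t \<in> borel_measurable P" for t
    unfolding lin_form_def[abs_def] using Y by (intro borel_measurable_sum borel_measurable_times) auto
  have lin: "lin_form n Y t (\<phi> \<omega>) = lin_form n X t \<omega>" for t \<omega>
    unfolding lin_form_def by (intro sum.cong) (simp_all add: Y\<phi>)
  have Lp: "Lp_norm N p f = Lp_norm M p (\<lambda>\<omega>. f (\<phi> \<omega>))" if [measurable]: "f \<in> borel_measurable P" for f p
    unfolding Lp_norm_def N_def by (simp add: nn_integral_distr)
  have Lp_Y: "Lp_norm N p (Y i) = Lp_norm M p (X i)" if "i \<in> ?I" for i p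
    using Lp[OF Y[OF that]] that by (simp add: Y\<phi>)
  interpret N: prob_space N
    unfolding N_def by (rule prob_space_distr) (rule \<phi>)
  have YN: "Y i \<in> borel_measurable N" if "i \<in> ?I" for i
    using Y[OF that] by (simp add: N_def)
  \<comment> \<open>Independence means that the joint law is the product of the marginals; joint and
    marginal laws agree for \<open>X\<close> and \<open>Y\<close>.\<close>
  have indep: "N.indep_vars (\<lambda>_. borel) Y ?I"
  proof (subst N.indep_vars_iff_distr_eq_PiM'[OF I YN])
    have "distr N P (\<lambda>x. \<lambda>i\<in>?I. Y i x) = distr M P (\<lambda>\<omega>. \<lambda>i\<in>?I. X i \<omega>)"
    proof -
      have "(\<lambda>x. \<lambda>i\<in>?I. Y i x) \<in> measurable P P"
        unfolding P_def by (rule measurable_restrict) (use Y in \<open>simp add: P_def\<close>)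
      from distr_distr[OF this \<phi>] show ?thesis
        unfolding N_def by (simp add: o_def Y\<phi> cong: restrict_cong)
    qed
    also have "\<dots> = (\<Pi>\<^sub>M i\<in>?I. distr M borel (X i))"
      using adm indep_vars_iff_distr_eq_PiM'[OF I X] unfolding P_def admissible_def by simp
    also have "\<dots> = (\<Pi>\<^sub>M i\<in>?I. distr N borel (Y i))"
      unfolding N_def using Y by (intro PiM_cong) (auto simp: distr_distr o_def Y\<phi>)
    finally show "distr N (\<Pi>\<^sub>M i\<in>?I. borel) (\<lambda>x. \<lambda>i\<in>?I. Y i x) = (\<Pi>\<^sub>M i\<in>?I. distr N borel (Y i))"
      by (simp add: P_def)
  qed
  have mean: "has_bochner_integral N (Y i) 0" if "i \<in> ?I" for i
    using adm that integrable_distr_eq[OF \<phi> Y[OF that]] integral_distr[OF \<phi> Y[OF that]]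
    unfolding N_def admissible_def has_bochner_integral_iff by (simp add: Y\<phi>)
  have "admissible N \<alpha> n Y"
    unfolding admissible_def
    using N.prob_space_axioms indep mean adm by (simp add: Lp_Y admissible_def)
  with assms n S have "ennreal c * small_m N n Y S \<le> big_M N n Y S \<and> big_M N n Y S \<le> ennreal C * small_m N n Y S"
    unfolding comparison_def by blast
  moreover have "small_m N n Y S = small_m M n X S"
    unfolding small_m_def by (simp add: Lp lin)
  moreover have "big_M N n Y S = big_M M n X S"
  proof -
    have "(\<integral>\<^sup>+\<omega>. ennreal \<bar>lin_form n Y t \<omega>\<bar> * indicator {\<omega>. u \<le> \<bar>lin_form n Y t \<omega>\<bar>} \<omega> \<partial>N)
        = (\<integral>\<^sup>+\<omega>. ennreal \<bar>lin_form n X t \<omega>\<bar> * indicator {\<omega>. u \<le> \<bar>lin_form n X t \<omega>\<bar>} \<omega> \<partial>M)" for t u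
      unfolding N_def by (subst nn_integral_distr) (auto simp: lin indicator_def)
    then show ?thesis
      unfolding big_M_def by simp
  qed
  ultimately show "ennreal c * small_m M n X S \<le> big_M M n X S \<and> big_M M n X S \<le> ennreal C * small_m M n X S"
    by simp
qed

theorem proposition5:
  fixes \<alpha> :: real
  shows "(\<exists>c C. 0 < c \<and> c \<le> C \<and> comparison TYPE(nat \<Rightarrow> real) \<alpha> c C) \<and>
    (\<forall>c C. comparison TYPE(nat \<Rightarrow> real) \<alpha> c C \<longrightarrow> comparison TYPE('a) \<alpha> c C)"
  using comparison_exists comparison_transfer by blast

end
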